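(* Let $k$ be a field of characteristic zero and let $A$ be any standard graded artinian $k$-algebra of codimension $3$, socle degree $c$ and multiplicity $e$. Let $t,i$ be the integers attached to $A$ as defined in the context, and for $l=1,2,3$ let $m_l$ be the smallest shift appearing in the $l$-th module $F_l$ of the minimal free resolution of $A$. If $$\frac{t\cdot i\cdot (c+3)}{6}\le e,$$ then $$\frac{m_1m_2m_3}{6}\le e .$$
   Context: $k$ is a field of characteristic zero, $R=k[x_1,x_2,x_3]$ with all $x_i$ of degree $1$, and $A=R/I$ is artinian with $I$ a homogeneous ideal containing no nonzero form of degree $1$. The $h$-vector of $A$ is $h(A)=(h_0,h_1,\dots,h_c)$, $h_i=\dim_k A_i$, where $c$ (the socle degree) is the last index with $A_c\ne0$; the codimension is $h_1=3$ and the multiplicity is $e=h_0+\dots+h_c=\dim_k A$. The graded minimal free resolution of $A$ over $R$ is $0\to F_3\to F_2\to F_1\to R\to R/I\to 0$ with $F_l=\bigoplus_d R^{\beta_{l,d}}(-d)$; the shifts appearing in $F_l$ are the integers $d$ with $\beta_{l,d}>0$. Set $h_n=0$ for $n<0$ and for $n>c$, and for every integer $n$ put $$f(n)=h_n-3h_{n-1}+3h_{n-2}-h_{n-3}.$$ Let $t$ be the initial degree of $I$ (the least degree in which $I$ is nonzero), and let $i$ be the smallest positive integer such that $f(i)>0$. *)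

theory Defs
  imports
    Complex_Main
    "HOL-Library.Poly_Mapping"
    "HOL-Library.Numeral_Type"
    "HOL-Algebra.Embedded_Algebras"
    "HOL-Algebra.QuotRing"
    "HOL-Algebra.Algebraic_Closure_Type"
begin

text \<open>
  A monomial is an exponent vector, finitely supported over the three-element type
  \<^typ>\<open>3\<close>; a polynomial is a finitely supported coefficient function on monomials.
\<close>

type_synonym 'k poly3 = "(3 \<Rightarrow>\<^sub>0 nat) \<Rightarrow>\<^sub>0 'k"

definition mdeg :: "(3 \<Rightarrow>\<^sub>0 nat) \<Rightarrow> nat" where
  "mdeg m = (\<Sum>j\<in>UNIV. Poly_Mapping.lookup m j)"

text \<open>
  Forms are indexed by integer degrees, so that twists of the ring are easy to write; the only
  form of negative degree is 0, and 0 is a form of every degree.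
\<close>

definition is_form :: "int \<Rightarrow> 'k::zero poly3 \<Rightarrow> bool" where
  "is_form n p \<longleftrightarrow> (\<forall>m \<in> Poly_Mapping.keys p. int (mdeg m) = n)"

definition hom_component :: "nat \<Rightarrow> 'k::comm_monoid_add poly3 \<Rightarrow> 'k poly3" where
  "hom_component n p =
     (\<Sum>m \<in> {m \<in> Poly_Mapping.keys p. mdeg m = n}. Poly_Mapping.single m (Poly_Mapping.lookup p m))"

definition const_poly :: "'k::zero \<Rightarrow> 'k poly3" where
  "const_poly a = Poly_Mapping.single 0 a"

definition irrelevant_ideal :: "'k::zero poly3 set" where
  "irrelevant_ideal = {p. Poly_Mapping.lookup p 0 = 0}"

abbreviation poly_ring :: "'k::comm_ring_1 poly3 ring" where
  "poly_ring \<equiv> ring_of_type_algebra"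

definition homogeneous_ideal :: "'k::comm_ring_1 poly3 set \<Rightarrow> bool" where
  "homogeneous_ideal I \<longleftrightarrow> ideal I poly_ring \<and> (\<forall>p \<in> I. \<forall>n. hom_component n p \<in> I)"

definition artinian :: "('a, 'b) ring_scheme \<Rightarrow> bool" where
  "artinian A \<longleftrightarrow> ring A \<and> \<not> (\<exists>J :: nat \<Rightarrow> 'a set. \<forall>n. ideal (J n) A \<and> J (Suc n) \<subset> J n)"

definition quot_alg :: "'k::comm_ring_1 poly3 set \<Rightarrow> 'k poly3 set ring" where
  "quot_alg I = poly_ring Quot I"

definition quot_class :: "'k::comm_ring_1 poly3 set \<Rightarrow> 'k poly3 \<Rightarrow> 'k poly3 set" where
  "quot_class I p = I +>\<^bsub>poly_ring\<^esub> p"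

text \<open>The copy of the ground field inside the quotient algebra.\<close>

definition quot_scalars :: "'k::comm_ring_1 poly3 set \<Rightarrow> 'k poly3 set set" where
  "quot_scalars I = range (\<lambda>a. quot_class I (const_poly a))"

definition quot_part :: "'k::comm_ring_1 poly3 set \<Rightarrow> int \<Rightarrow> 'k poly3 set set" where
  "quot_part I n = quot_class I ` {p. is_form n p}"

definition hilb :: "'k::comm_ring_1 poly3 set \<Rightarrow> int \<Rightarrow> nat" where
  "hilb I n = ring.dim (quot_alg I) (quot_scalars I) (quot_part I n)"

definition alg_multiplicity :: "'k::comm_ring_1 poly3 set \<Rightarrow> nat" where
  "alg_multiplicity I = ring.dim (quot_alg I) (quot_scalars I) (carrier (quot_alg I))"

definition socle_degree :: "'k::comm_ring_1 poly3 set \<Rightarrow> nat" where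
  "socle_degree I = (GREATEST n. quot_part I (int n) \<noteq> {\<zero>\<^bsub>quot_alg I\<^esub>})"

definition initial_degree :: "'k::comm_ring_1 poly3 set \<Rightarrow> nat" where
  "initial_degree I = (LEAST n. \<exists>p \<in> I. p \<noteq> 0 \<and> is_form (int n) p)"

definition third_diff :: "'k::comm_ring_1 poly3 set \<Rightarrow> int \<Rightarrow> int" where
  "third_diff I n =
     int (hilb I n) - 3 * int (hilb I (n - 1)) + 3 * int (hilb I (n - 2)) - int (hilb I (n - 3))"

definition first_pos_diff :: "'k::comm_ring_1 poly3 set \<Rightarrow> nat" where
  "first_pos_diff I = (LEAST n. n > 0 \<and> third_diff I (int n) > 0)"

text \<open>
  For \<open>b :: int \<Rightarrow> nat\<close> with finite support, the graded free module
  \<open>\<Oplus>\<^sub>d R(-d)\<^bsup>b d\<^esup>\<close> has one basis element of degree \<open>d\<close> for each pair \<open>(d, j)\<close> with \<open>j < b d\<close>.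
  Its elements are the coordinate functions vanishing off these pairs. An element is homogeneous
  of degree \<open>n\<close> if its \<open>(d, j)\<close> coordinate is a form of degree \<open>n - d\<close>.
\<close>

type_synonym 'k fvec = "int \<times> nat \<Rightarrow> 'k poly3"

definition shifts :: "(int \<Rightarrow> nat) \<Rightarrow> int set" where
  "shifts b = {d. b d > 0}"

definition free_module :: "(int \<Rightarrow> nat) \<Rightarrow> 'k::zero fvec set" where
  "free_module b = {v. \<forall>d j. b d \<le> j \<longrightarrow> v (d, j) = 0}"

definition free_part :: "(int \<Rightarrow> nat) \<Rightarrow> int \<Rightarrow> 'k::zero fvec set" where
  "free_part b n = {v \<in> free_module b. \<forall>d j. is_form (n - d) (v (d, j))}"

definition graded_hom ::
    "(int \<Rightarrow> nat) \<Rightarrow> (int \<Rightarrow> nat) \<Rightarrow> ('k::comm_ring_1 fvec \<Rightarrow> 'k fvec) \<Rightarrow> bool" where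
  "graded_hom b b' \<phi> \<longleftrightarrow>
     \<phi> ` free_module b \<subseteq> free_module b' \<and>
     (\<forall>u \<in> free_module b. \<forall>v \<in> free_module b. \<phi> (\<lambda>x. u x + v x) = (\<lambda>x. \<phi> u x + \<phi> v x)) \<and>
     (\<forall>r. \<forall>v \<in> free_module b. \<phi> (\<lambda>x. r * v x) = (\<lambda>x. r * \<phi> v x)) \<and>
     (\<forall>n. \<phi> ` free_part b n \<subseteq> free_part b' n)"

text \<open>
  \<open>\<phi> l\<close> is the differential \<open>F\<^sub>l \<rightarrow> F\<^sub>l\<^sub>-\<^sub>1\<close> for \<open>l = 1, 2, 3\<close>, where \<open>F\<^sub>0 = R\<close> is the free module on the
  single basis element \<open>(0, 0)\<close>; the values of \<open>\<beta>\<close> and \<open>\<phi>\<close> at other indices play no role.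
  Minimality is the condition \<open>\<phi>\<^sub>l(F\<^sub>l) \<subseteq> \<mm> F\<^sub>l\<^sub>-\<^sub>1\<close>, where \<open>\<mm>\<close> is the irrelevant ideal.
\<close>

definition minimal_free_resolution ::
    "'k::comm_ring_1 poly3 set \<Rightarrow> (nat \<Rightarrow> int \<Rightarrow> nat) \<Rightarrow> (nat \<Rightarrow> 'k fvec \<Rightarrow> 'k fvec) \<Rightarrow> bool" where
  "minimal_free_resolution I \<beta> \<phi> \<longleftrightarrow>
     (\<forall>d. \<beta> 0 d = (if d = 0 then 1 else 0)) \<and>
     (\<forall>l \<in> {1, 2, 3}.
        finite (shifts (\<beta> l)) \<and>
        graded_hom (\<beta> l) (\<beta> (l - 1)) (\<phi> l) \<and>
        (\<forall>v \<in> free_module (\<beta> l). \<forall>x. \<phi> l v x \<in> irrelevant_ideal)) \<and>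
     \<phi> 1 ` free_module (\<beta> 1) = {v \<in> free_module (\<beta> 0). v (0, 0) \<in> I} \<and>
     \<phi> 2 ` free_module (\<beta> 2) = {v \<in> free_module (\<beta> 1). \<phi> 1 v = (\<lambda>_. 0)} \<and>
     \<phi> 3 ` free_module (\<beta> 3) = {v \<in> free_module (\<beta> 2). \<phi> 2 v = (\<lambda>_. 0)} \<and>
     inj_on (\<phi> 3) (free_module (\<beta> 3))"

definition min_shift :: "(int \<Rightarrow> nat) \<Rightarrow> int" where
  "min_shift b = Min (shifts b)"

end

theory Submission
  imports Defs "HOL-Library.Function_Algebras" "HOL-Library.Infinite_Set"
begin

text \<open>
  It suffices to show \<open>0 < m\<^sub>1 \<le> t\<close>, \<open>0 < m\<^sub>2 \<le> i\<close> and \<open>0 < m\<^sub>3 \<le> c + 3\<close>. Positivity follows from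
  minimality, and \<open>m\<^sub>1 \<le> t\<close> because a form of degree \<open>t\<close> in \<open>I\<close> comes from \<open>F\<^sub>1\<close>. Counting dimensions
  in the resolution gives \<open>f(n) = - \<beta>\<^bsub>1,n\<^esub> + \<beta>\<^bsub>2,n\<^esub> - \<beta>\<^bsub>3,n\<^esub>\<close> for \<open>n > 0\<close>, so \<open>f(i) > 0\<close> forces a
  shift \<open>i\<close> in \<open>F\<^sub>2\<close>; that \<open>i\<close> exists follows from the finite support of the Hilbert function.
  Finally, a nonzero element of \<open>A\<^sub>c\<close> lies in the socle, and comparing the Koszul complex of the
  variables with the resolution yields a shift at most \<open>c + 3\<close> in \<open>F\<^sub>3\<close>.
\<close>

section \<open>Polynomials in three variables\<close>

text \<open>The operator f is the inverse of the Hilbert series of R: that series is 1/(1-z)^3, and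
  a third difference is multiplication by (1-z)^3, so each twist R(-d) contributes exactly one unit,
  at n = d. Since \<open>\<beta> 1\<close> and \<open>\<beta> 3\<close> enter f(n) with a minus
  sign, a positive value can come from \<open>\<beta> 2\<close> alone. Two kinds of linear algebra
  have to meet. \<open>hilb\<close> is a dimension inside the quotient ring over the image of k,
  while the resolution is counted in k-vector spaces of polynomials and vectors;
  \<open>hilb_eq\<close> is the bridge. The differentials are constrained on
  \<open>free_module\<close> alone, so they become linear maps on the whole space only after
  composition with the projection \<open>proj\<close> to one degree. The bound on the third shift
  reflects that Tor_3(A,k) can be computed from the resolution of A or from the Koszul resolution of
  k, where it is the socle of A shifted by 3. An explicit chain map and homotopy stand in for
  Tor.\<close>

lemma UNIV_3_eq: "(UNIV :: 3 set) = {0, 1, 2}"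
proof -
  have "x = 0 \<or> x = 1 \<or> x = 2" for x :: 3
  proof (induct x)
    case (of_int z)
    then have "z = 0 \<or> z = 1 \<or> z = 2" by simp arith
    then show ?case by auto
  qed
  then show ?thesis by auto
qed

lemma mdeg_eq: "mdeg m = Poly_Mapping.lookup m 0 + Poly_Mapping.lookup m 1 + Poly_Mapping.lookup m 2"
  unfolding mdeg_def UNIV_3_eq by simp

lemma mdeg_add: "mdeg (m + m') = mdeg m + mdeg m'"
  by (simp add: mdeg_eq lookup_add)

lemma mdeg_single: "mdeg (Poly_Mapping.single j a) = a"
  unfolding mdeg_def by (simp add: lookup_single when_def)

lemma mdeg_eq_0_iff: "mdeg m = 0 \<longleftrightarrow> m = 0"
proof -
  have "m = 0" if "mdeg m = 0"
    using that unfolding mdeg_def by (intro poly_mapping_eqI) simp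
  then show ?thesis by (auto simp: mdeg_def)
qed

lemma lookup_single_times:
  fixes p :: "'k::comm_ring_1 poly3"
  shows "Poly_Mapping.lookup (Poly_Mapping.single t c * p) (t + m) = c * Poly_Mapping.lookup p m"
  by (simp add: lookup_mult lookup_single when_mult)

lemma lookup_single_times_eq_0:
  fixes p :: "'k::comm_ring_1 poly3"
  assumes "\<And>m. k \<noteq> t + m"
  shows "Poly_Mapping.lookup (Poly_Mapping.single t c * p) k = 0"
  using assms by (simp add: lookup_mult lookup_single when_mult)

lemma lookup_const_poly_times:
  fixes p :: "'k::comm_ring_1 poly3"
  shows "Poly_Mapping.lookup (const_poly a * p) m = a * Poly_Mapping.lookup p m"
  unfolding const_poly_def using lookup_single_times[of 0 a p m] by simp

section \<open>Forms and homogeneous components\<close>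

lemma is_form_iff:
  "is_form n p \<longleftrightarrow> (\<forall>m. Poly_Mapping.lookup p m \<noteq> 0 \<longrightarrow> int (mdeg m) = n)"
  unfolding is_form_def by (auto simp: in_keys_iff)

lemma is_form_zero: "is_form n 0"
  by (simp add: is_form_iff)

lemma is_form_add: "is_form n p \<Longrightarrow> is_form n q \<Longrightarrow> is_form n (p + q)"
  for p :: "'k::comm_ring_1 poly3"
  unfolding is_form_iff lookup_add by (metis add_0)

lemma is_form_uminus: "is_form n p \<Longrightarrow> is_form n (- p)"
  for p :: "'k::comm_ring_1 poly3"
  unfolding is_form_iff by simp

lemma is_form_diff: "is_form n p \<Longrightarrow> is_form n q \<Longrightarrow> is_form n (p - q)"
  for p :: "'k::comm_ring_1 poly3"
  using is_form_add[of n p "- q"] is_form_uminus[of n q] by simp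

lemma is_form_const_times: "is_form n p \<Longrightarrow> is_form n (const_poly a * p)"
  for p :: "'k::comm_ring_1 poly3"
  unfolding is_form_iff lookup_const_poly_times by (metis mult_zero_right)

lemma is_form_neg: "is_form n p \<Longrightarrow> n < 0 \<Longrightarrow> p = 0"
  unfolding is_form_iff by (intro poly_mapping_eqI) force

text \<open>This is how minimality is exploited: a nonzero homogeneous entry of a differential
  cannot have degree 0.\<close>

lemma is_form_0_irrelevant: "is_form 0 p \<Longrightarrow> p \<in> irrelevant_ideal \<Longrightarrow> p = 0"
  unfolding is_form_iff irrelevant_ideal_def
  by (intro poly_mapping_eqI) (auto simp: mdeg_eq_0_iff)

lemma is_form_single: "is_form (int (mdeg m)) (Poly_Mapping.single m a)"
  unfolding is_form_iff by (simp add: lookup_single when_def)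

text \<open>Integer degrees are needed for twists: the component of degree \<open>n - d\<close> must
  be 0 when \<open>n < d\<close>, whereas \<open>nat (n - d)\<close> would select the constant
  term.\<close>

definition graded_comp :: "int \<Rightarrow> 'k::comm_monoid_add poly3 \<Rightarrow> 'k poly3" where
  "graded_comp n p = (if n < 0 then 0 else hom_component (nat n) p)"

lemma lookup_hom_component:
  "Poly_Mapping.lookup (hom_component n p) m = (if mdeg m = n then Poly_Mapping.lookup p m else 0)"
proof -
  have "Poly_Mapping.lookup (hom_component n p) m =
      (\<Sum>m'\<in>{m' \<in> Poly_Mapping.keys p. mdeg m' = n}. if m' = m then Poly_Mapping.lookup p m' else 0)"
    unfolding hom_component_def lookup_sum by (simp add: lookup_single when_def)
  also have "\<dots> = (if mdeg m = n then Poly_Mapping.lookup p m else 0)"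
    by (subst sum.delta) (auto simp: in_keys_iff)
  finally show ?thesis .
qed

lemma lookup_graded_comp:
  "Poly_Mapping.lookup (graded_comp n p) m =
     (if int (mdeg m) = n then Poly_Mapping.lookup p m else 0)"
  unfolding graded_comp_def by (auto simp: lookup_hom_component)

lemma is_form_graded_comp: "is_form n (graded_comp n p)"
  by (simp add: is_form_iff lookup_graded_comp)

lemma graded_comp_form:
  "is_form m p \<Longrightarrow> graded_comp n p = (if n = m then p else 0)"
  by (rule poly_mapping_eqI) (auto simp: is_form_iff lookup_graded_comp)

lemma graded_comp_add: "graded_comp n (p + q) = graded_comp n p + graded_comp n q"
  for p :: "'k::comm_ring_1 poly3"
  by (rule poly_mapping_eqI) (simp add: lookup_graded_comp lookup_add)

lemma graded_comp_const_times:
  "graded_comp n (const_poly a * p) = const_poly a * graded_comp n p"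
  for p :: "'k::comm_ring_1 poly3"
  by (rule poly_mapping_eqI) (simp add: lookup_graded_comp lookup_const_poly_times)

lemma graded_comp_zero [simp]: "graded_comp n 0 = 0"
  by (rule poly_mapping_eqI) (simp add: lookup_graded_comp)

lemma sum_graded_comp:
  assumes "finite N" and "\<And>m. m \<in> Poly_Mapping.keys p \<Longrightarrow> int (mdeg m) \<in> N"
  shows "(\<Sum>n\<in>N. graded_comp n p) = p"
proof (rule poly_mapping_eqI)
  fix m
  show "Poly_Mapping.lookup (\<Sum>n\<in>N. graded_comp n p) m = Poly_Mapping.lookup p m"
    using assms by (auto simp: lookup_sum lookup_graded_comp in_keys_iff sum.delta')
qed

section \<open>Multiplication and division by a variable\<close>

definition xvar :: "3 \<Rightarrow> 'k::comm_ring_1 poly3" where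
  "xvar j = Poly_Mapping.single (Poly_Mapping.single j 1) 1"

text \<open>Terms not divisible by the variable are dropped, which makes division total and
  additive.\<close>

definition div_var :: "3 \<Rightarrow> 'k::comm_ring_1 poly3 \<Rightarrow> 'k poly3" where
  "div_var j p = Poly_Mapping.map_key (\<lambda>m. Poly_Mapping.single j 1 + m) p"

lemma lookup_div_var:
  "Poly_Mapping.lookup (div_var j p) m = Poly_Mapping.lookup p (Poly_Mapping.single j 1 + m)"
  unfolding div_var_def by (simp add: map_key.rep_eq inj_on_def)

lemma div_var_zero [simp]: "div_var j 0 = 0"
  by (rule poly_mapping_eqI) (simp add: lookup_div_var)

lemma div_var_add: "div_var j (p + q) = div_var j p + div_var j q"
  by (rule poly_mapping_eqI) (simp add: lookup_div_var lookup_add)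

lemma div_var_same: "div_var j (xvar j * p) = p"
  by (rule poly_mapping_eqI) (simp add: lookup_div_var xvar_def lookup_single_times)

lemma add_single_eq:
  assumes "Poly_Mapping.lookup m j \<noteq> 0"
  obtains m' where "m = Poly_Mapping.single j (1::nat) + m'"
proof
  show "m = Poly_Mapping.single j (1::nat) + (m - Poly_Mapping.single j 1)"
    using assms by (intro poly_mapping_eqI) (auto simp: lookup_add lookup_minus lookup_single when_def)
qed

lemma div_var_other:
  assumes "i \<noteq> j"
  shows "div_var j (xvar i * p) = xvar i * div_var j p"
proof (rule poly_mapping_eqI)
  fix m
  show "Poly_Mapping.lookup (div_var j (xvar i * p)) m = Poly_Mapping.lookup (xvar i * div_var j p) m"
  proof (cases "Poly_Mapping.lookup m i = 0")
    case True
    \<comment> \<open>Multiplying m by the other variable does not make it divisible by variable i,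
      so both coefficients vanish.\<close>
    have "m \<noteq> Poly_Mapping.single i 1 + m'" "Poly_Mapping.single j 1 + m \<noteq> Poly_Mapping.single i 1 + m'" for m'
      using True assms by (auto simp: poly_mapping_eq_iff fun_eq_iff lookup_add lookup_single when_def intro!: exI[of _ i])
    then show ?thesis
      unfolding lookup_div_var xvar_def by (simp add: lookup_single_times_eq_0)
  next
    case False
    then obtain m' where m': "m = Poly_Mapping.single i (1::nat) + m'" by (rule add_single_eq)
    have "Poly_Mapping.single j 1 + m = Poly_Mapping.single i (1::nat) + (Poly_Mapping.single j 1 + m')"
      by (simp add: m' ac_simps)
    then show ?thesis
      unfolding lookup_div_var xvar_def using m' by (simp only: lookup_single_times lookup_div_var[unfolded xvar_def])
  qed
qed

lemma xvar_cancel: "xvar j * p = xvar j * q \<Longrightarrow> p = q"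
  by (metis div_var_same)

lemma is_form_xvar_times: "is_form n p \<Longrightarrow> is_form (n + 1) (xvar j * p)"
proof -
  assume *: "is_form n p"
  show ?thesis
    unfolding is_form_iff
  proof (intro allI impI)
    fix m assume m: "Poly_Mapping.lookup (xvar j * p) m \<noteq> 0"
    then obtain m' where m': "m = Poly_Mapping.single j 1 + m'"
      unfolding xvar_def using lookup_single_times_eq_0 by metis
    with m have "Poly_Mapping.lookup p m' \<noteq> 0"
      unfolding xvar_def by (simp add: lookup_single_times)
    then show "int (mdeg m) = n + 1"
      using * by (simp add: is_form_iff m' mdeg_add mdeg_single)
  qed
qed

text \<open>Koszul exactness is elementary and explicit here: \<^const>\<open>div_var\<close> is a retraction of
  multiplication by a variable and commutes with the other variables.\<close>

lemma koszul_exact_1: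
  assumes "\<And>i j. xvar i * v j = xvar j * v i"
  shows "v i = xvar i * div_var 0 (v 0)"
proof -
  have other: "v j = xvar j * div_var 0 (v 0)" if "j \<noteq> 0" for j
    using assms[of 0 j] that by (metis div_var_other div_var_same)
  \<comment> \<open>The relation of index 0 with itself is void, so index 0 is reached through
    variable 1, which is then cancelled.\<close>
  moreover have "v 0 = xvar 0 * div_var 0 (v 0)"
  proof (rule xvar_cancel)
    have "xvar 1 * v 0 = xvar 0 * v 1" by (rule assms)
    also have "v 1 = xvar 1 * div_var 0 (v 0)" by (rule other) simp
    finally show "xvar 1 * v 0 = xvar 1 * (xvar 0 * div_var 0 (v 0))" by (simp add: ac_simps)
  qed
  ultimately show ?thesis by (cases "i = 0") auto
qed

lemma koszul_exact_2:
  fixes p q r :: "'k::comm_ring_1 poly3"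
  assumes "xvar 0 * p + xvar 1 * q + xvar 2 * r = 0"
  defines "a \<equiv> div_var 0 q" and "b \<equiv> div_var 0 r"
  defines "c \<equiv> div_var 1 (r - xvar 0 * b)"
  shows "p = - (xvar 1 * a) - xvar 2 * b" "q = xvar 0 * a - xvar 2 * c" "r = xvar 0 * b + xvar 1 * c"
proof -
  \<comment> \<open>Division by variable 0 solves for p. Removing the multiples
    \<open>xvar 0 * a\<close> and \<open>xvar 0 * b\<close> from q and r leaves a relation between
    variables 1 and 2, which division by variable 1 solves in the same way.\<close>
  have "div_var 0 (xvar 0 * p + xvar 1 * q + xvar 2 * r) = 0"
    using assms(1) by simp
  then have 1: "p + xvar 1 * a + xvar 2 * b = 0"
    unfolding div_var_add a_def b_def by (simp add: div_var_same div_var_other)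
  then show p: "p = - (xvar 1 * a) - xvar 2 * b"
    by (simp add: algebra_simps eq_neg_iff_add_eq_0)
  define q' where "q' = q - xvar 0 * a"
  define r' where "r' = r - xvar 0 * b"
  have qr: "xvar 1 * q' + xvar 2 * r' = 0"
    using assms(1) unfolding q'_def r'_def p by (simp add: algebra_simps)
  then have "div_var 1 (xvar 1 * q' + xvar 2 * r') = 0" by simp
  then have 2: "q' + xvar 2 * c = 0"
    unfolding div_var_add c_def r'_def by (simp add: div_var_same div_var_other)
  then show "q = xvar 0 * a - xvar 2 * c"
    unfolding q'_def by (simp add: algebra_simps eq_neg_iff_add_eq_0)
  have "xvar 2 * r' = xvar 2 * (xvar 1 * c)"
  proof -
    have "q' = - (xvar 2 * c)" using 2 by (simp add: eq_neg_iff_add_eq_0)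
    then show ?thesis using qr by (simp add: algebra_simps)
  qed
  then show "r = xvar 0 * b + xvar 1 * c"
    using xvar_cancel unfolding r'_def by (metis add.commute diff_eq_eq)
qed

section \<open>Dimension counts\<close>

text \<open>Rank-nullity on a finitely spanned subspace, as the ambient spaces are
  infinite-dimensional. A basis \<open>B0\<close> of the kernel in V is extended to a basis
  \<open>B\<close> of V; the added vectors \<open>C\<close> map to a basis of the image.\<close>

lemma (in vector_space_pair) dim_eq_dim_kernel_plus_dim_image:
  assumes f: "Vector_Spaces.linear s1 s2 f" and V: "vs1.subspace V"
    and T: "finite T" "V \<subseteq> vs1.span T"
  shows "vs1.dim V = vs1.dim {v \<in> V. f v = 0} + vs2.dim (f ` V)"
proof -
  interpret f: Vector_Spaces.linear s1 s2 f by (fact f)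
  define K where "K = {v \<in> V. f v = 0}"
  obtain B0 where B0: "B0 \<subseteq> K" "vs1.independent B0" "K \<subseteq> vs1.span B0" "card B0 = vs1.dim K"
    by (rule vs1.basis_exists)
  have "B0 \<subseteq> V" using B0(1) by (auto simp: K_def)
  then obtain B where B: "B0 \<subseteq> B" "B \<subseteq> V" "vs1.independent B" "V \<subseteq> vs1.span B"
    using vs1.maximal_independent_subset_extend B0(2) by metis
  have "finite B" using vs1.independent_span_bound[OF T(1) B(3)] B(2) T(2) by auto
  define C where "C = B - B0"
  have CV: "vs1.span C \<subseteq> V"
    using B(2) V by (intro vs1.span_minimal) (auto simp: C_def)
  have inj: "inj_on f (vs1.span C)"
  proof (subst f.inj_on_iff_eq_0)
    show "\<forall>x\<in>vs1.span C. f x = 0 \<longrightarrow> x = 0"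
    proof (intro ballI impI)
      fix x assume x: "x \<in> vs1.span C" "f x = 0"
      then have xB0: "x \<in> vs1.span B0" using CV B0(3) by (auto simp: K_def)
      \<comment> \<open>The coordinates of x with respect to \<open>B\<close> are supported on
        \<open>C\<close> and also on \<open>B0\<close>; these are disjoint, so all coordinates
        vanish.\<close>
      have "vs1.representation B x = vs1.representation C x"
        "vs1.representation B x = vs1.representation B0 x"
        using x(1) xB0 B by (auto intro!: vs1.representation_extend simp: C_def)
      then have "vs1.representation B x b = 0" for b
        using vs1.representation_ne_zero[of C x b] vs1.representation_ne_zero[of B0 x b]
        by (auto simp: C_def)
      moreover have "x \<in> vs1.span B" using x CV B(4) by auto
      ultimately show "x = 0"
        using vs1.sum_nonzero_representation_eq[OF B(3), of x] by simp
    qed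
  qed simp
  have "vs2.dim (f ` V) = card C"
  proof (rule vs2.dim_unique)
    show "f ` C \<subseteq> f ` V" using B(2) by (auto simp: C_def)
    show "vs2.independent (f ` C)"
      by (rule f.independent_injective_image[OF _ inj]) (use B(3) vs1.independent_mono in \<open>auto simp: C_def\<close>)
    show "card (f ` C) = card C"
      using inj vs1.span_superset inj_on_subset by (intro card_image) blast
    have "f ` B \<subseteq> insert 0 (f ` C)" using B0(1) by (auto simp: C_def K_def)
    then have "vs2.span (f ` B) \<subseteq> vs2.span (f ` C)"
      using vs2.span_mono[of "f ` B" "insert 0 (f ` C)"] by (simp only: vs2.span_insert_0)
    then show "f ` V \<subseteq> vs2.span (f ` C)"
      using f.spans_image[OF B(4)] by auto
  qed
  moreover have "vs1.dim V = card B"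
    using B by (intro vs1.dim_unique) auto
  moreover have "card B = card B0 + card C"
    using B(1) \<open>finite B\<close> unfolding C_def by (metis card_Diff_subset card_mono finite_subset le_add_diff_inverse)
  ultimately show ?thesis using B0(4) by (simp add: K_def)
qed

lemma const_poly_add: "const_poly (a + b) = const_poly a + const_poly b"
  for a :: "'k::comm_ring_1"
  unfolding const_poly_def by (rule single_add)

lemma const_poly_mult: "const_poly (a * b) = const_poly a * const_poly b"
  for a :: "'k::comm_ring_1"
  unfolding const_poly_def by (simp add: mult_single)

lemma const_poly_1: "const_poly 1 = (1 :: 'k::comm_ring_1 poly3)"
  unfolding const_poly_def by (rule single_one)

definition pscale :: "'k::comm_ring_1 \<Rightarrow> 'k poly3 \<Rightarrow> 'k poly3" where
  "pscale a p = const_poly a * p"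

definition fscale :: "'k::comm_ring_1 \<Rightarrow> 'k fvec \<Rightarrow> 'k fvec" where
  "fscale a v = (\<lambda>x. const_poly a * v x)"

interpretation pv: vector_space "pscale :: 'k::field \<Rightarrow> 'k poly3 \<Rightarrow> 'k poly3"
  by unfold_locales
    (simp_all add: pscale_def const_poly_add const_poly_mult const_poly_1 algebra_simps)

interpretation fv: vector_space "fscale :: 'k::field \<Rightarrow> 'k fvec \<Rightarrow> 'k fvec"
  by unfold_locales
    (simp_all add: fscale_def fun_eq_iff const_poly_add const_poly_mult const_poly_1 algebra_simps)

interpretation fpv: vector_space_pair "fscale :: 'k::field \<Rightarrow> 'k fvec \<Rightarrow> 'k fvec"
    "pscale :: 'k::field \<Rightarrow> 'k poly3 \<Rightarrow> 'k poly3"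
  by unfold_locales

interpretation ffv: vector_space_pair "fscale :: 'k::field \<Rightarrow> 'k fvec \<Rightarrow> 'k fvec"
    "fscale :: 'k::field \<Rightarrow> 'k fvec \<Rightarrow> 'k fvec"
  by unfold_locales

section \<open>Counting monomials of a given degree\<close>

definition mono_set :: "int \<Rightarrow> (3 \<Rightarrow>\<^sub>0 nat) set" where
  "mono_set n = {m. int (mdeg m) = n}"

lemma mono_set_neg: "n < 0 \<Longrightarrow> mono_set n = {}"
  by (auto simp: mono_set_def)

lemma bij_betw_mono_set:
  "bij_betw (\<lambda>m. (Poly_Mapping.lookup m 0, Poly_Mapping.lookup m 1)) (mono_set (int k))
     (Sigma {..k} (\<lambda>a. {..k - a}))"
  (is "bij_betw ?f _ _")
proof (rule bij_betwI[where g = "\<lambda>(a, b). Poly_Mapping.single 0 a + Poly_Mapping.single 1 b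
    + Poly_Mapping.single 2 (k - a - b)"])
  show "?f \<in> mono_set (int k) \<rightarrow> Sigma {..k} (\<lambda>a. {..k - a})"
    by (auto simp: mono_set_def mdeg_eq)
  show "(\<lambda>(a, b). Poly_Mapping.single 0 a + Poly_Mapping.single 1 b
      + Poly_Mapping.single 2 (k - a - b)) \<in> Sigma {..k} (\<lambda>a. {..k - a}) \<rightarrow> mono_set (int k)"
    by (auto simp: mono_set_def mdeg_add mdeg_single)
  show "(case ?f m of (a, b) \<Rightarrow> Poly_Mapping.single 0 a + Poly_Mapping.single 1 b
      + Poly_Mapping.single 2 (k - a - b)) = m" if "m \<in> mono_set (int k)" for m
  proof (rule poly_mapping_eqI)
    fix j :: 3
    have "j \<in> {0, 1, 2}" using UNIV_3_eq by auto
    then show "Poly_Mapping.lookup (case ?f m of (a, b) \<Rightarrow> Poly_Mapping.single 0 a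
        + Poly_Mapping.single 1 b + Poly_Mapping.single 2 (k - a - b)) j = Poly_Mapping.lookup m j"
      using that by (auto simp: mono_set_def mdeg_eq lookup_add lookup_single when_def)
  qed
qed (auto simp: lookup_add lookup_single when_def)

lemma sum_Suc_diff_triangle: "2 * (\<Sum>a\<le>k. Suc (k - a)) = (k + 1) * (k + 2)"
  by (induction k) (simp_all add: sum.atMost_Suc_shift del: sum.atMost_Suc)

text \<open>The formula holds down to -2 because the quadratic polynomial vanishes at -1 and -2.
  This is just far enough for a third difference at n = 1, which reaches back to n - 3 = -2.\<close>

lemma card_mono_set: "n \<ge> -2 \<Longrightarrow> 2 * int (card (mono_set n)) = (n + 1) * (n + 2)"
proof -
  assume "n \<ge> -2"
  then consider "n = -2" | "n = -1" | k where "n = int k"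
    using zero_le_imp_eq_int[of n] by fastforce
  then show ?thesis
  proof cases
    case 3
    have "card (mono_set n) = (\<Sum>a\<le>k. Suc (k - a))"
      unfolding 3 bij_betw_same_card[OF bij_betw_mono_set] by simp
    then show ?thesis using sum_Suc_diff_triangle[of k] unfolding 3
      by (metis (no_types, lifting) int_ops(3) of_nat_1 of_nat_add of_nat_mult of_nat_numeral)
  qed (simp_all add: mono_set_neg)
qed

lemma finite_mono_set: "finite (mono_set n)"
proof (cases "n < 0")
  case False
  then obtain k where "n = int k" using zero_le_imp_eq_int by (auto simp: not_less)
  then show ?thesis using bij_betw_finite[OF bij_betw_mono_set[of k]] by simp
qed (simp add: mono_set_neg)

text \<open>For positive n this is the third difference of a quadratic polynomial. At n = 0 the
  polynomial would have the value 1 at -3, where no monomials exist; hence the 1.\<close>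

lemma third_diff_card_mono_set:
  "int (card (mono_set n)) - 3 * int (card (mono_set (n - 1))) + 3 * int (card (mono_set (n - 2)))
     - int (card (mono_set (n - 3))) = (if n = 0 then 1 else 0)"
proof -
  consider "n < 0" | "n = 0" | "n \<ge> 1" by linarith
  then show ?thesis
  proof cases
    case 2
    then show ?thesis using card_mono_set[of 0] by (simp add: mono_set_neg)
  next
    case 3
    then have "2 * (int (card (mono_set n)) - 3 * int (card (mono_set (n - 1)))
        + 3 * int (card (mono_set (n - 2))) - int (card (mono_set (n - 3)))) = 0"
      using card_mono_set[of n] card_mono_set[of "n - 1"] card_mono_set[of "n - 2"] card_mono_set[of "n - 3"]
      by (simp add: algebra_simps)
    then show ?thesis using 3 by simp
  qed (simp add: mono_set_neg)
qed

text \<open>The monomial basis of the degree \<open>n\<close> part of a graded free module is indexed by triples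
  (degree of a basis element, its number, monomial).\<close>

definition part_index :: "(int \<Rightarrow> nat) \<Rightarrow> int \<Rightarrow> (int \<times> nat \<times> (3 \<Rightarrow>\<^sub>0 nat)) set" where
  "part_index b n = Sigma (shifts b) (\<lambda>d. {..<b d} \<times> mono_set (n - d))"

definition mono_vec :: "int \<times> nat \<times> (3 \<Rightarrow>\<^sub>0 nat) \<Rightarrow> 'k::comm_ring_1 fvec" where
  "mono_vec = (\<lambda>(d, j, m) x. if x = (d, j) then Poly_Mapping.single m 1 else 0)"

definition coord :: "'k::comm_ring_1 fvec \<Rightarrow> int \<times> nat \<times> (3 \<Rightarrow>\<^sub>0 nat) \<Rightarrow> 'k" where
  "coord v = (\<lambda>(d, j, m). Poly_Mapping.lookup (v (d, j)) m)"

lemma coord_eqI: "(\<And>t. coord u t = coord v t) \<Longrightarrow> u = v"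
  unfolding coord_def by (force intro!: poly_mapping_eqI)

lemma coord_mono_vec: "coord (mono_vec s) t = (if s = t then 1 else 0)"
  unfolding coord_def mono_vec_def by (auto simp: lookup_single when_def split: prod.splits)

lemma coord_add: "coord (u + v) t = coord u t + coord v t"
  unfolding coord_def by (auto simp: lookup_add split: prod.splits)

lemma coord_zero: "coord 0 t = 0"
  unfolding coord_def by (auto split: prod.splits)

lemma coord_fscale: "coord (fscale a v) t = a * coord v t"
  unfolding coord_def fscale_def by (auto simp: lookup_const_poly_times split: prod.splits)

lemma coord_sum: "coord (\<Sum>s\<in>S. v s) t = (\<Sum>s\<in>S. coord (v s) t)"
  by (induction S rule: infinite_finite_induct)
    (simp_all only: coord_add coord_zero sum.infinite sum.empty sum.insert not_False_eq_True)

lemma coord_combination: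
  "finite S \<Longrightarrow> coord (\<Sum>s\<in>S. fscale (c s) (mono_vec s)) t = (if t \<in> S then c t else 0)"
  by (simp add: coord_sum coord_fscale coord_mono_vec if_distrib cong: if_cong)

lemma inj_mono_vec: "inj (mono_vec :: _ \<Rightarrow> 'k::comm_ring_1 fvec)"
proof (rule injI)
  fix s t :: "int \<times> nat \<times> (3 \<Rightarrow>\<^sub>0 nat)"
  assume "(mono_vec s :: 'k fvec) = mono_vec t"
  then have "coord (mono_vec s :: 'k fvec) s = coord (mono_vec t :: 'k fvec) s" by simp
  then show "s = t" by (simp add: coord_mono_vec split: if_splits)
qed

lemma finite_part_index: "finite (shifts b) \<Longrightarrow> finite (part_index b n)"
  unfolding part_index_def by (auto simp: finite_mono_set)

lemma independent_mono_vec: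
  fixes S :: "(int \<times> nat \<times> (3 \<Rightarrow>\<^sub>0 nat)) set"
  assumes "finite S"
  shows "fv.independent (mono_vec ` S :: 'k::field fvec set)"
proof (rule fv.independent_if_scalars_zero)
  fix c :: "'k fvec \<Rightarrow> 'k" and x :: "'k fvec"
  assume sum: "(\<Sum>x\<in>mono_vec ` S. fscale (c x) x) = 0" and "x \<in> mono_vec ` S"
  then obtain s where s: "s \<in> S" "x = mono_vec s" by auto
  have "(\<Sum>s\<in>S. fscale (c (mono_vec s)) (mono_vec s)) = (0 :: 'k fvec)"
    using sum by (subst (asm) sum.reindex) (auto intro: inj_on_subset[OF inj_mono_vec])
  then have "coord (\<Sum>s\<in>S. fscale (c (mono_vec s)) (mono_vec s)) s = 0"
    by (simp add: coord_zero)
  then show "c x = 0" using coord_combination[OF assms, of "\<lambda>s. c (mono_vec s)" s] s by simp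
qed (use assms in auto)

lemma mono_vec_in_free_part: "t \<in> part_index b n \<Longrightarrow> mono_vec t \<in> free_part b n"
  unfolding part_index_def mono_vec_def free_part_def free_module_def mono_set_def
  by (auto simp: is_form_iff lookup_single when_def split: if_splits)

lemma free_part_combination:
  assumes "finite (shifts b)" and "v \<in> free_part b n"
  shows "v = (\<Sum>t\<in>part_index b n. fscale (coord v t) (mono_vec t))"
proof (rule coord_eqI)
  fix t
  have "coord v t = 0" if "t \<notin> part_index b n"
  proof (rule ccontr)
    obtain d j m where t: "t = (d, j, m)" by (cases t)
    assume "coord v t \<noteq> 0"
    then have nz: "Poly_Mapping.lookup (v (d, j)) m \<noteq> 0" by (simp add: coord_def t)
    then have "j < b d" using assms(2) unfolding free_part_def free_module_def
      by (metis (mono_tags, lifting) lookup_zero mem_Collect_eq not_less)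
    moreover have "int (mdeg m) = n - d"
      using nz assms(2) unfolding free_part_def is_form_iff by blast
    ultimately show False using that by (auto simp: t part_index_def shifts_def mono_set_def)
  qed
  then show "coord v t = coord (\<Sum>t\<in>part_index b n. fscale (coord v t) (mono_vec t)) t"
    using coord_combination[OF finite_part_index[OF assms(1)], of "coord v"] by simp
qed

lemma free_part_subset_span:
  fixes b :: "int \<Rightarrow> nat"
  assumes "finite (shifts b)"
  shows "free_part b n \<subseteq> fv.span (mono_vec ` part_index b n :: 'k::field fvec set)"
proof
  fix v :: "'k fvec" assume "v \<in> free_part b n"
  then have "v = (\<Sum>t\<in>part_index b n. fscale (coord v t) (mono_vec t))"
    by (rule free_part_combination[OF assms])
  also have "\<dots> \<in> fv.span (mono_vec ` part_index b n)"
    by (intro fv.span_sum fv.span_scale fv.span_base) auto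
  finally show "v \<in> fv.span (mono_vec ` part_index b n)" .
qed

lemma dim_free_part:
  assumes "finite (shifts b)"
  shows "fv.dim (free_part b n :: 'k::field fvec set) = (\<Sum>d\<in>shifts b. b d * card (mono_set (n - d)))"
proof -
  have "fv.dim (free_part b n :: 'k fvec set) = card (part_index b n)"
  proof (rule fv.dim_unique)
    show "mono_vec ` part_index b n \<subseteq> (free_part b n :: 'k fvec set)"
      using mono_vec_in_free_part by auto
    show "free_part b n \<subseteq> fv.span (mono_vec ` part_index b n :: 'k fvec set)"
      by (rule free_part_subset_span[OF assms])
    show "fv.independent (mono_vec ` part_index b n :: 'k fvec set)"
      by (rule independent_mono_vec[OF finite_part_index[OF assms]])
    show "card (mono_vec ` part_index b n :: 'k fvec set) = card (part_index b n)"
      by (rule card_image[OF inj_on_subset[OF inj_mono_vec]]) simp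
  qed
  then show ?thesis
    using assms by (simp add: part_index_def finite_mono_set card_cartesian_product)
qed

lemma subspace_free_part: "fv.subspace (free_part b n)"
  by (rule fv.subspaceI)
    (auto simp: free_part_def free_module_def is_form_zero is_form_add fscale_def is_form_const_times)

text \<open>Each basis element of degree d contributes a translate by d of the monomial count, whose
  third difference is concentrated at n = d.\<close>

lemma third_diff_dim_free_part:
  assumes "finite (shifts b)"
  defines "D \<equiv> \<lambda>n. int (fv.dim (free_part b n :: 'k::field fvec set))"
  shows "D n - 3 * D (n - 1) + 3 * D (n - 2) - D (n - 3) = int (b n)"
proof -
  have "D n - 3 * D (n - 1) + 3 * D (n - 2) - D (n - 3) = (\<Sum>d\<in>shifts b. int (b d) *
      (int (card (mono_set (n - d))) - 3 * int (card (mono_set (n - d - 1)))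
        + 3 * int (card (mono_set (n - d - 2))) - int (card (mono_set (n - d - 3)))))"
    unfolding D_def dim_free_part[OF assms(1)]
    by (simp add: sum_distrib_left sum.distrib[symmetric] sum_subtractf[symmetric] algebra_simps)
  also have "\<dots> = (\<Sum>d\<in>shifts b. if d = n then int (b d) else 0)"
    unfolding third_diff_card_mono_set by (intro sum.cong) auto
  also have "\<dots> = int (b n)"
    using assms(1) by (auto simp: sum.delta' shifts_def)
  finally show ?thesis .
qed

section \<open>Graded free resolutions\<close>

lemma sum_fun_apply: "(\<Sum>s\<in>S. f s) x = (\<Sum>s\<in>S. f s x)"
  for f :: "'i \<Rightarrow> 'x \<Rightarrow> 'y::comm_monoid_add"
  by (induction S rule: infinite_finite_induct)
    (simp_all only: plus_fun_apply zero_fun_apply sum.infinite sum.empty sum.insert not_False_eq_True)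

definition rscale :: "'k::comm_ring_1 poly3 \<Rightarrow> 'k fvec \<Rightarrow> 'k fvec" where
  "rscale r v = (\<lambda>x. r * v x)"

lemma rscale_apply [simp]: "rscale r v x = r * v x"
  by (simp add: rscale_def)

lemma free_part_subset: "free_part b n \<subseteq> free_module b"
  by (auto simp: free_part_def)

lemma free_module_add: "u \<in> free_module b \<Longrightarrow> v \<in> free_module b \<Longrightarrow> u + v \<in> free_module b"
  for u :: "'k::comm_ring_1 fvec"
  by (simp add: free_module_def)

lemma free_module_diff: "u \<in> free_module b \<Longrightarrow> v \<in> free_module b \<Longrightarrow> u - v \<in> free_module b"
  for u :: "'k::comm_ring_1 fvec"
  by (simp add: free_module_def)

lemma free_module_rscale: "v \<in> free_module b \<Longrightarrow> rscale r v \<in> free_module b"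
  by (simp add: free_module_def)

lemma free_module_zero: "0 \<in> free_module b"
  by (simp add: free_module_def)

lemma free_part_add: "u \<in> free_part b n \<Longrightarrow> v \<in> free_part b n \<Longrightarrow> u + v \<in> free_part b n"
  for u :: "'k::comm_ring_1 fvec"
  by (simp add: free_part_def free_module_add is_form_add)

lemma free_part_diff: "u \<in> free_part b n \<Longrightarrow> v \<in> free_part b n \<Longrightarrow> u - v \<in> free_part b n"
  for u :: "'k::comm_ring_1 fvec"
  by (simp add: free_part_def free_module_diff is_form_diff)

lemma free_part_xvar: "v \<in> free_part b n \<Longrightarrow> rscale (xvar j) v \<in> free_part b (n + 1)"
  unfolding free_part_def
  by (auto simp: free_module_rscale dest!: spec intro: is_form_xvar_times[of "n - d" for d, simplified diff_add_eq])

lemma free_part_eq_0: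
  assumes "v \<in> free_part b n" and "\<And>d. b d > 0 \<Longrightarrow> n < d"
  shows "v = 0"
proof
  fix x :: "int \<times> nat"
  obtain d j where x: "x = (d, j)" by (cases x)
  show "v x = 0 x"
  proof (cases "b d = 0")
    case True
    then show ?thesis using assms(1) by (simp add: x free_part_def free_module_def)
  next
    case False
    then have "n - d < 0" using assms(2)[of d] by simp
    then show ?thesis using assms(1) is_form_neg unfolding x free_part_def by fastforce
  qed
qed

lemma graded_hom_mem: "graded_hom b b' \<phi> \<Longrightarrow> v \<in> free_module b \<Longrightarrow> \<phi> v \<in> free_module b'"
  by (auto simp: graded_hom_def)

lemma graded_hom_part: "graded_hom b b' \<phi> \<Longrightarrow> v \<in> free_part b n \<Longrightarrow> \<phi> v \<in> free_part b' n"
  unfolding graded_hom_def by blast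

lemma graded_hom_add:
  "graded_hom b b' \<phi> \<Longrightarrow> u \<in> free_module b \<Longrightarrow> v \<in> free_module b \<Longrightarrow> \<phi> (u + v) = \<phi> u + \<phi> v"
  by (simp add: graded_hom_def plus_fun_def)

lemma graded_hom_rscale:
  "graded_hom b b' \<phi> \<Longrightarrow> v \<in> free_module b \<Longrightarrow> \<phi> (rscale r v) = rscale r (\<phi> v)"
  by (simp add: graded_hom_def rscale_def)

lemma graded_hom_zero:
  fixes \<phi> :: "'k::comm_ring_1 fvec \<Rightarrow> 'k fvec"
  assumes "graded_hom b b' \<phi>"
  shows "\<phi> 0 = 0"
proof -
  have "\<phi> (rscale 0 0) = rscale 0 (\<phi> 0)"
    by (rule graded_hom_rscale[OF assms free_module_zero])
  then show ?thesis by (simp add: rscale_def zero_fun_def)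
qed

lemma graded_hom_diff:
  fixes \<phi> :: "'k::comm_ring_1 fvec \<Rightarrow> 'k fvec"
  assumes "graded_hom b b' \<phi>" "u \<in> free_module b" "v \<in> free_module b"
  shows "\<phi> (u - v) = \<phi> u - \<phi> v"
proof -
  have "\<phi> u = \<phi> ((u - v) + v)" by simp
  also have "\<dots> = \<phi> (u - v) + \<phi> v"
    by (intro graded_hom_add[OF assms(1)] free_module_diff assms)
  finally show ?thesis by simp
qed

lemma graded_hom_sum:
  fixes \<phi> :: "'k::comm_ring_1 fvec \<Rightarrow> 'k fvec"
  assumes "graded_hom b b' \<phi>" "\<And>s. s \<in> S \<Longrightarrow> v s \<in> free_module b"
  shows "\<phi> (\<Sum>s\<in>S. v s) = (\<Sum>s\<in>S. \<phi> (v s))"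
proof -
  have "(\<Sum>s\<in>S. v s) \<in> free_module b \<and> \<phi> (\<Sum>s\<in>S. v s) = (\<Sum>s\<in>S. \<phi> (v s))"
    using assms(2)
  proof (induction S rule: infinite_finite_induct)
    case (insert s S)
    then have "v s \<in> free_module b" "(\<Sum>s\<in>S. v s) \<in> free_module b"
      "\<phi> (\<Sum>s\<in>S. v s) = (\<Sum>s\<in>S. \<phi> (v s))" by auto
    then show ?case
      unfolding sum.insert[OF insert.hyps] using graded_hom_add[OF assms(1)] free_module_add by metis
  qed (simp_all only: sum.infinite sum.empty free_module_zero graded_hom_zero[OF assms(1)] simp_thms)
  then show ?thesis by simp
qed

text \<open>Coordinates outside the basis are cut off, so that every coordinate function, not just
  an element of \<open>free_module b\<close>, is sent into \<open>free_part b n\<close>.\<close>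

definition proj :: "(int \<Rightarrow> nat) \<Rightarrow> int \<Rightarrow> 'k::comm_ring_1 fvec \<Rightarrow> 'k fvec" where
  "proj b n v = (\<lambda>(d, j). if j < b d then graded_comp (n - d) (v (d, j)) else 0)"

lemma proj_in_free_part: "proj b n v \<in> free_part b n"
  by (simp add: proj_def free_part_def free_module_def is_form_graded_comp is_form_zero)

lemma proj_free_part: "v \<in> free_part b m \<Longrightarrow> proj b n v = (if n = m then v else 0)"
  unfolding fun_eq_iff
proof (intro allI)
  fix x :: "int \<times> nat"
  assume v: "v \<in> free_part b m"
  obtain d j where x: "x = (d, j)" by (cases x)
  have "is_form (m - d) (v x)" using v by (simp add: free_part_def x)
  moreover have "v x = 0" if "\<not> j < b d"
    using v that by (simp add: free_part_def free_module_def x)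
  ultimately show "proj b n v x = (if n = m then v else 0) x"
    by (auto simp: proj_def x graded_comp_form)
qed

lemma proj_add: "proj b n (u + v) = proj b n u + proj b n v"
  by (auto simp: proj_def fun_eq_iff graded_comp_add)

lemma proj_fscale: "proj b n (fscale a v) = fscale a (proj b n v)"
  by (auto simp: proj_def fscale_def fun_eq_iff graded_comp_const_times)

lemma proj_sum: "proj b n (\<Sum>s\<in>S. v s) = (\<Sum>s\<in>S. proj b n (v s))"
proof (induction S rule: infinite_finite_induct)
  case (insert s S)
  then show ?case by (simp only: sum.insert proj_add not_False_eq_True)
qed (simp_all only: sum.infinite sum.empty, simp_all add: proj_def fun_eq_iff)

lemma sum_proj:
  assumes "finite (shifts b)" and v: "v \<in> free_module b"
  obtains N where "finite N" and "n \<in> N" and "(\<Sum>n\<in>N. proj b n v) = v"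
proof
  \<comment> \<open>These are the degrees of all terms of v, counted with the degree of their basis
    element. The given n is added so that the summand of degree n can be picked out later.\<close>
  define N where "N = insert n (\<Union>(d, j)\<in>Sigma (shifts b) (\<lambda>d. {..<b d}).
      (\<lambda>m. d + int (mdeg m)) ` Poly_Mapping.keys (v (d, j)))"
  show "finite N" unfolding N_def using assms(1) by auto
  show "n \<in> N" by (simp add: N_def)
  show "(\<Sum>n\<in>N. proj b n v) = v"
  proof
    fix x :: "int \<times> nat"
    obtain d j where x: "x = (d, j)" by (cases x)
    show "(\<Sum>n\<in>N. proj b n v) x = v x"
    proof (cases "j < b d")
      case False
      then show ?thesis using v unfolding sum_fun_apply by (simp add: x proj_def free_module_def)
    next
      case True
      have "(\<Sum>n\<in>N. proj b n v) x = (\<Sum>n\<in>N. graded_comp (n - d) (v x))"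
        unfolding sum_fun_apply using True by (simp add: x proj_def)
      also have "\<dots> = (\<Sum>n\<in>(\<lambda>n. n - d) ` N. graded_comp n (v x))"
        by (subst sum.reindex) (auto simp: inj_on_def)
      also have "\<dots> = v x"
      proof (rule sum_graded_comp)
        show "finite ((\<lambda>n. n - d) ` N)" using \<open>finite N\<close> by simp
        fix m assume "m \<in> Poly_Mapping.keys (v x)"
        then have "d + int (mdeg m) \<in> N"
          using True unfolding N_def x by (force simp: shifts_def)
        then show "int (mdeg m) \<in> (\<lambda>n. n - d) ` N"
          by (metis add_diff_cancel_left' imageI)
      qed
      finally show ?thesis .
    qed
  qed
qed

text \<open>The vector is split into finitely many homogeneous pieces; each is mapped into its own
  degree, and projecting the image keeps the piece of degree n.\<close>

lemma graded_hom_proj: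
  fixes \<phi> :: "'k::comm_ring_1 fvec \<Rightarrow> 'k fvec"
  assumes "graded_hom b b' \<phi>" "finite (shifts b)" "v \<in> free_module b"
  shows "\<phi> (proj b n v) = proj b' n (\<phi> v)"
proof -
  obtain N where N: "finite N" "n \<in> N" "(\<Sum>k\<in>N. proj b k v) = v"
    using sum_proj[OF assms(2,3), of n] by blast
  have "proj b' n (\<phi> v) = proj b' n (\<phi> (\<Sum>k\<in>N. proj b k v))"
    by (simp only: N(3))
  also have "\<dots> = (\<Sum>k\<in>N. proj b' n (\<phi> (proj b k v)))"
    by (subst graded_hom_sum[OF assms(1)])
      (simp_all add: proj_sum subsetD[OF free_part_subset proj_in_free_part])
  also have "\<dots> = (\<Sum>k\<in>N. if k = n then \<phi> (proj b n v) else 0)"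
    by (rule sum.cong[OF refl])
      (use proj_free_part[OF graded_hom_part[OF assms(1) proj_in_free_part]] in auto)
  also have "\<dots> = \<phi> (proj b n v)"
    unfolding sum.delta[OF N(1)] if_P[OF N(2)] by (rule refl)
  finally show ?thesis by simp
qed

text \<open>Exactness passes to each degree: a preimage of a homogeneous vector can be replaced by
  its component of that degree.\<close>

lemma graded_hom_image_part:
  fixes \<phi> :: "'k::comm_ring_1 fvec \<Rightarrow> 'k fvec"
  assumes "graded_hom b b' \<phi>" "finite (shifts b)"
    and im: "\<phi> ` free_module b = {v \<in> free_module b'. P v}"
  shows "\<phi> ` free_part b n = {v \<in> free_part b' n. P v}"
proof (intro equalityI subsetI)
  fix v assume "v \<in> \<phi> ` free_part b n"
  then show "v \<in> {v \<in> free_part b' n. P v}"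
    using graded_hom_part[OF assms(1)] im free_part_subset by blast
next
  fix v assume "v \<in> {v \<in> free_part b' n. P v}"
  then have v: "v \<in> free_part b' n" "v \<in> \<phi> ` free_module b"
    using im free_part_subset by blast+
  then obtain w where w: "w \<in> free_module b" "v = \<phi> w" by auto
  have "v = \<phi> (proj b n w)"
    unfolding graded_hom_proj[OF assms(1,2) w(1)] using v(1) w(2) proj_free_part by metis
  then show "v \<in> \<phi> ` free_part b n" using proj_in_free_part by blast
qed

text \<open>\<open>graded_hom\<close> says nothing outside \<open>free_module b\<close>, while
  linearity is required everywhere. Projecting first repairs this and leaves the values on
  \<open>free_part b n\<close> unchanged.\<close>

lemma linear_graded_hom_proj:
  fixes \<phi> :: "'k::field fvec \<Rightarrow> 'k fvec"
  assumes "graded_hom b b' \<phi>"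
  shows "Vector_Spaces.linear fscale fscale (\<lambda>v. \<phi> (proj b n v))"
proof -
  have "proj b n v \<in> free_module b" for v :: "'k fvec"
    using proj_in_free_part free_part_subset by blast
  then have "\<phi> (proj b n (u + v)) = \<phi> (proj b n u) + \<phi> (proj b n v)"
    "\<phi> (proj b n (fscale c v)) = fscale c (\<phi> (proj b n v))" for u v c
    using graded_hom_add[OF assms] graded_hom_rscale[OF assms, of _ "const_poly c"]
    unfolding proj_add proj_fscale by (simp_all add: fscale_def rscale_def)
  then show ?thesis
    using fv.vector_space_axioms unfolding Vector_Spaces.linear_iff by blast
qed

lemma dim_free_part_eq:
  fixes \<phi> :: "'k::field fvec \<Rightarrow> 'k fvec"
  assumes "graded_hom b b' \<phi>" "finite (shifts b)"
  shows "fv.dim (free_part b n :: 'k fvec set) =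
    fv.dim {v \<in> free_part b n. \<phi> v = 0} + fv.dim (\<phi> ` free_part b n)"
proof -
  have *: "\<phi> (proj b n v) = \<phi> v" if "v \<in> free_part b n" for v
    using that proj_free_part[of v b n n] by simp
  have "fv.dim (free_part b n :: 'k fvec set) = fv.dim {v \<in> free_part b n. \<phi> (proj b n v) = 0}
      + fv.dim ((\<lambda>v. \<phi> (proj b n v)) ` free_part b n)"
    by (rule ffv.dim_eq_dim_kernel_plus_dim_image[OF linear_graded_hom_proj[OF assms(1)]
          subspace_free_part _ free_part_subset_span[OF assms(2)]])
      (simp add: finite_part_index[OF assms(2)])
  then show ?thesis
    using * by (simp cong: conj_cong image_cong)
qed

section \<open>Consequences of a minimal free resolution\<close>

locale min_res =
  fixes I :: "'k::field poly3 set" and \<beta> :: "nat \<Rightarrow> int \<Rightarrow> nat" and \<phi> :: "nat \<Rightarrow> 'k fvec \<Rightarrow> 'k fvec"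
  assumes res: "minimal_free_resolution I \<beta> \<phi>"
begin

lemma beta_0: "\<beta> 0 d = (if d = 0 then 1 else 0)"
  using res by (simp add: minimal_free_resolution_def)

lemma finite_shifts: "finite (shifts (\<beta> 1))" "finite (shifts (\<beta> 2))" "finite (shifts (\<beta> 3))"
  using res by (auto simp: minimal_free_resolution_def)

lemma hom1: "graded_hom (\<beta> 1) (\<beta> 0) (\<phi> 1)"
  and hom2: "graded_hom (\<beta> 2) (\<beta> 1) (\<phi> 2)"
  and hom3: "graded_hom (\<beta> 3) (\<beta> 2) (\<phi> 3)"
proof -
  have "\<forall>l\<in>{1, 2, 3}. graded_hom (\<beta> l) (\<beta> (l - 1)) (\<phi> l)"
    using res unfolding minimal_free_resolution_def by blast
  then show "graded_hom (\<beta> 1) (\<beta> 0) (\<phi> 1)" "graded_hom (\<beta> 2) (\<beta> 1) (\<phi> 2)"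
    "graded_hom (\<beta> 3) (\<beta> 2) (\<phi> 3)" by (simp_all add: numeral_eq_Suc)
qed

lemma minimal: "l \<in> {1, 2, 3} \<Longrightarrow> v \<in> free_module (\<beta> l) \<Longrightarrow> \<phi> l v x \<in> irrelevant_ideal"
  using res unfolding minimal_free_resolution_def by blast

lemma exact0: "\<phi> 1 ` free_module (\<beta> 1) = {v \<in> free_module (\<beta> 0). v (0, 0) \<in> I}"
  and exact1: "\<phi> 2 ` free_module (\<beta> 2) = {v \<in> free_module (\<beta> 1). \<phi> 1 v = 0}"
  and exact2: "\<phi> 3 ` free_module (\<beta> 3) = {v \<in> free_module (\<beta> 2). \<phi> 2 v = 0}"
  and inj3: "inj_on (\<phi> 3) (free_module (\<beta> 3))"
  using res by (simp_all add: minimal_free_resolution_def zero_fun_def)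

lemmas exact0_part = graded_hom_image_part[OF hom1 finite_shifts(1) exact0]
lemmas exact1_part = graded_hom_image_part[OF hom2 finite_shifts(2) exact1]
lemmas exact2_part = graded_hom_image_part[OF hom3 finite_shifts(3) exact2]

lemma free_module_0_eq: "v \<in> free_module (\<beta> 0) \<Longrightarrow> v = (\<lambda>x. if x = (0, 0) then v (0, 0) else 0)"
proof
  fix x :: "int \<times> nat"
  assume v: "v \<in> free_module (\<beta> 0)"
  obtain d j where x: "x = (d, j)" by (cases x)
  have "v x = 0" if "x \<noteq> (0, 0)"
    using v that unfolding free_module_def beta_0 x by (cases "d = 0") auto
  then show "v x = (if x = (0, 0) then v (0, 0) else 0)" by simp
qed

lemma free_part_0_iff:
  "(\<lambda>x. if x = (0, 0) then p else 0) \<in> free_part (\<beta> 0) n \<longleftrightarrow> is_form n p"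
  by (auto simp: free_part_def free_module_def beta_0 is_form_zero split: if_splits dest: spec[of _ 0])

text \<open>Rank-nullity is applied to the three differentials in degree n; by exactness each kernel
  is the preceding image, and injectivity of \<open>\<phi> 3\<close> ends the alternating
  sum.\<close>

lemma dim_ideal_part:
  "int (pv.dim {p \<in> I. is_form n p}) = int (fv.dim (free_part (\<beta> 1) n :: 'k fvec set))
     - int (fv.dim (free_part (\<beta> 2) n :: 'k fvec set))
     + int (fv.dim (free_part (\<beta> 3) n :: 'k fvec set))"
proof -
  have inj: "{v \<in> free_part (\<beta> 3) n. \<phi> 3 v = 0} = {0}"
  proof (intro equalityI subsetI)
    fix v assume "v \<in> {v \<in> free_part (\<beta> 3) n. \<phi> 3 v = 0}"
    then have "v \<in> free_module (\<beta> 3)" "\<phi> 3 v = \<phi> 3 0"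
      using free_part_subset graded_hom_zero[OF hom3] by auto
    then show "v \<in> {0}" using inj_onD[OF inj3 _ _ free_module_zero] by blast
  qed (use graded_hom_zero[OF hom3] fv.subspace_0[OF subspace_free_part] in auto)
  have zero: "fv.dim {0 :: 'k fvec} = 0"
    by (rule fv.dim_unique[of "{}"]) (auto simp: fv.independent_empty)
  have 3: "fv.dim (free_part (\<beta> 3) n :: 'k fvec set) = fv.dim {v \<in> free_part (\<beta> 2) n. \<phi> 2 v = 0}"
    using dim_free_part_eq[OF hom3 finite_shifts(3), of n] by (simp only: inj zero exact2_part)
  have 2: "fv.dim (free_part (\<beta> 2) n :: 'k fvec set) = fv.dim {v \<in> free_part (\<beta> 2) n. \<phi> 2 v = 0}
      + fv.dim {v \<in> free_part (\<beta> 1) n. \<phi> 1 v = 0}"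
    using dim_free_part_eq[OF hom2 finite_shifts(2), of n] by (simp only: exact1_part)
  \<comment> \<open>Evaluation at the single basis element identifies the module \<open>F_0\<close>
    with R, so that the image becomes a space of polynomials.\<close>
  define f where "f = (\<lambda>v. \<phi> 1 (proj (\<beta> 1) n v) (0, 0))"
  have f: "f v = \<phi> 1 v (0, 0)" if "v \<in> free_part (\<beta> 1) n" for v
    using that proj_free_part[of v "\<beta> 1" n n] by (simp add: f_def)
  have linear: "Vector_Spaces.linear fscale pscale f"
    using linear_graded_hom_proj[OF hom1, of n] pv.vector_space_axioms
    unfolding Vector_Spaces.linear_iff f_def by (simp add: fscale_def pscale_def)
  have "{v \<in> free_part (\<beta> 1) n. f v = 0} = {v \<in> free_part (\<beta> 1) n. \<phi> 1 v = 0}"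
  proof -
    have "\<phi> 1 v (0, 0) = 0 \<longleftrightarrow> \<phi> 1 v = 0" if "v \<in> free_part (\<beta> 1) n" for v
    proof
      assume *: "\<phi> 1 v (0, 0) = 0"
      have "\<phi> 1 v \<in> free_module (\<beta> 0)"
        using that free_part_subset graded_hom_mem[OF hom1] by blast
      from free_module_0_eq[OF this] show "\<phi> 1 v = 0" unfolding * by (simp add: zero_fun_def)
    qed simp
    then show ?thesis using f by auto
  qed
  moreover have "f ` free_part (\<beta> 1) n = {p \<in> I. is_form n p}"
  proof -
    have "f ` free_part (\<beta> 1) n = (\<lambda>v. v (0, 0)) ` \<phi> 1 ` free_part (\<beta> 1) n"
      unfolding image_image by (rule image_cong[OF refl f])
    also have "\<dots> = {p \<in> I. is_form n p}"
      unfolding exact0_part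
    proof (intro equalityI subsetI)
      fix p assume "p \<in> {p \<in> I. is_form n p}"
      then show "p \<in> (\<lambda>v. v (0, 0)) ` {v \<in> free_part (\<beta> 0) n. v (0, 0) \<in> I}"
        by (intro image_eqI[of _ _ "\<lambda>x. if x = (0, 0) then p else 0"]) (auto simp: free_part_0_iff)
    next
      fix p assume "p \<in> (\<lambda>v. v (0, 0)) ` {v \<in> free_part (\<beta> 0) n. v (0, 0) \<in> I}"
      then show "p \<in> {p \<in> I. is_form n p}"
        by (auto simp: free_part_def dest: spec[of _ 0])
    qed
    finally show ?thesis .
  qed
  ultimately have 1: "fv.dim (free_part (\<beta> 1) n :: 'k fvec set) =
      fv.dim {v \<in> free_part (\<beta> 1) n. \<phi> 1 v = 0} + pv.dim {p \<in> I. is_form n p}"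
    using fpv.dim_eq_dim_kernel_plus_dim_image[OF linear subspace_free_part _
        free_part_subset_span[OF finite_shifts(1)]]
      finite_part_index[OF finite_shifts(1)] by simp
  show ?thesis using 1 2 3 by simp
qed

text \<open>A nonzero coordinate of the image of a basis vector is a form of degree
  \<open>d - d'\<close>. This degree is not negative, and by minimality it is not 0.\<close>

lemma shift_lt:
  assumes "graded_hom b b' \<psi>" and "\<And>v x. v \<in> free_module b \<Longrightarrow> \<psi> v x \<in> irrelevant_ideal"
    and "b d > 0" and "\<psi> (mono_vec (d, 0, 0)) \<noteq> (0 :: 'k fvec)"
  obtains d' where "b' d' > 0" "d' < d"
proof -
  have e: "mono_vec (d, 0, 0) \<in> (free_part b d :: 'k fvec set)"
    using assms(3) by (intro mono_vec_in_free_part) (simp add: part_index_def shifts_def mono_set_def mdeg_def)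
  obtain d' j where dj: "\<psi> (mono_vec (d, 0, 0)) (d', j) \<noteq> 0"
    using assms(4) by (fastforce simp: fun_eq_iff)
  have in': "\<psi> (mono_vec (d, 0, 0)) \<in> free_part b' d"
    by (rule graded_hom_part[OF assms(1) e])
  then have "j < b' d'" using dj by (force simp: free_part_def free_module_def not_less[symmetric])
  moreover have "is_form (d - d') (\<psi> (mono_vec (d, 0, 0)) (d', j))"
    using in' by (simp add: free_part_def)
  moreover have "\<psi> (mono_vec (d, 0, 0)) (d', j) \<in> irrelevant_ideal"
    using e free_part_subset by (intro assms(2)) auto
  ultimately have "b' d' > 0" "d - d' \<noteq> 0" "\<not> d - d' < 0"
    using dj is_form_0_irrelevant[of "\<psi> (mono_vec (d, 0, 0)) (d', j)"]
      is_form_neg[of "d - d'" "\<psi> (mono_vec (d, 0, 0)) (d', j)"] by auto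
  then show thesis using that[of d'] by linarith
qed

lemma mono_vec_not_irrelevant: "mono_vec (d, 0, 0) (d, 0) \<notin> (irrelevant_ideal :: 'k poly3 set)"
  by (simp add: mono_vec_def irrelevant_ideal_def)

lemma basis_in_free_module: "b d > 0 \<Longrightarrow> mono_vec (d, 0, 0) \<in> free_module b"
  by (simp add: mono_vec_def free_module_def)

text \<open>A basis vector in the kernel would be an image under the next differential, but its
  coordinate 1 is not in the irrelevant ideal. So its image is nonzero and its degree exceeds the
  shift 0 of \<open>F_0\<close>.\<close>

lemma shifts_1_pos: "\<beta> 1 d > 0 \<Longrightarrow> d > 0"
proof -
  assume d: "\<beta> 1 d > 0"
  have "\<phi> 1 (mono_vec (d, 0, 0)) \<noteq> 0"
  proof
    assume "\<phi> 1 (mono_vec (d, 0, 0)) = 0"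
    then have "mono_vec (d, 0, 0) \<in> \<phi> 2 ` free_module (\<beta> 2)"
      unfolding exact1 using basis_in_free_module[of "\<beta> 1" d] d by simp
    then obtain v where v: "v \<in> free_module (\<beta> 2)" "mono_vec (d, 0, 0) = \<phi> 2 v" by auto
    have "\<phi> 2 v (d, 0) \<in> irrelevant_ideal" using v(1) by (intro minimal) simp_all
    then show False using mono_vec_not_irrelevant by (simp flip: v(2))
  qed
  then obtain d' where "\<beta> 0 d' > 0" "d' < d"
    using shift_lt[OF hom1 minimal d] by auto
  then show "d > 0" by (auto simp: beta_0 split: if_splits)
qed

lemma shifts_2_pos: "\<beta> 2 d > 0 \<Longrightarrow> d > 0"
proof -
  assume d: "\<beta> 2 d > 0"
  have "\<phi> 2 (mono_vec (d, 0, 0)) \<noteq> 0"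
  proof
    assume "\<phi> 2 (mono_vec (d, 0, 0)) = 0"
    then have "mono_vec (d, 0, 0) \<in> \<phi> 3 ` free_module (\<beta> 3)"
      unfolding exact2 using basis_in_free_module[of "\<beta> 2" d] d by simp
    then obtain v where v: "v \<in> free_module (\<beta> 3)" "mono_vec (d, 0, 0) = \<phi> 3 v" by auto
    have "\<phi> 3 v (d, 0) \<in> irrelevant_ideal" using v(1) by (intro minimal) simp_all
    then show False using mono_vec_not_irrelevant by (simp flip: v(2))
  qed
  then obtain d' where "\<beta> 1 d' > 0" "d' < d"
    using shift_lt[OF hom2 minimal d] by auto
  then show "d > 0" using shifts_1_pos[of d'] by linarith
qed

lemma shifts_3_pos: "\<beta> 3 d > 0 \<Longrightarrow> d > 0"
proof -
  assume d: "\<beta> 3 d > 0"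
  \<comment> \<open>At the last differential, injectivity takes the place of exactness.\<close>
  have "\<phi> 3 (mono_vec (d, 0, 0)) \<noteq> 0"
  proof
    assume "\<phi> 3 (mono_vec (d, 0, 0)) = 0"
    then have "mono_vec (d, 0, 0) = (0 :: 'k fvec)"
      using inj_onD[OF inj3, of "mono_vec (d, 0, 0)" 0] graded_hom_zero[OF hom3]
        basis_in_free_module[of "\<beta> 3" d] d free_module_zero by metis
    then show False using mono_vec_not_irrelevant[of d] by (simp add: irrelevant_ideal_def)
  qed
  then obtain d' where "\<beta> 2 d' > 0" "d' < d"
    using shift_lt[OF hom3 minimal d] by auto
  then show "d > 0" using shifts_2_pos[of d'] by linarith
qed

lemma shift_1_le:
  assumes "p \<in> I" "p \<noteq> 0" "is_form n p"
  obtains d where "\<beta> 1 d > 0" "d \<le> n"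
proof -
  define v where "v = (\<lambda>x :: int \<times> nat. if x = (0, 0) then p else 0)"
  have "v \<in> \<phi> 1 ` free_part (\<beta> 1) n"
    using assms unfolding exact0_part v_def by (simp only: mem_Collect_eq free_part_0_iff simp_thms if_True)
  then obtain u where u: "u \<in> free_part (\<beta> 1) n" "v = \<phi> 1 u" by auto
  have "u \<noteq> 0"
  proof
    assume "u = 0"
    then have "v (0, 0) = 0" using u(2) graded_hom_zero[OF hom1] by simp
    then show False using assms(2) by (simp add: v_def)
  qed
  then show thesis using free_part_eq_0[OF u(1)] that by (meson not_le)
qed

text \<open>A socle element \<open>s\<close> of degree \<open>c\<close> gives a map from the Koszul complex, shifted by \<open>c\<close>, to
  the resolution. If \<open>F\<^sub>3\<close> starts after degree \<open>c + 3\<close>, this map is zero at the last step, hence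
  null-homotopic by exactness of the Koszul complex, which forces \<open>s \<in> I\<close>.\<close>

lemma shift_3_le:
  assumes s: "is_form c s" "s \<notin> I" "\<And>j. xvar j * s \<in> I"
  obtains d where "\<beta> 3 d > 0" "d \<le> c + 3"
proof (rule ccontr)
  assume "\<not> thesis"
  with that have no_shift: "\<And>d. \<beta> 3 d > 0 \<Longrightarrow> c + 3 < d" by (meson not_le)
  \<comment> \<open>The chain map from the Koszul complex is built degree by degree:
    \<open>u j\<close> lifts the generator of index j, \<open>w i j\<close> lifts that of the pair
    i, j, and z is the cycle to be lifted for the top generator.\<close>
  have "\<exists>u. u \<in> free_part (\<beta> 1) (c + 1) \<and> \<phi> 1 u = (\<lambda>x. if x = (0, 0) then xvar j * s else 0)" for j
  proof -
    have "(\<lambda>x. if x = (0, 0) then xvar j * s else 0) \<in> \<phi> 1 ` free_part (\<beta> 1) (c + 1)"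
      using s(3) is_form_xvar_times[OF s(1)]
      unfolding exact0_part by (simp only: mem_Collect_eq free_part_0_iff simp_thms if_True)
    then show ?thesis by force
  qed
  then obtain u where u: "\<And>j. u j \<in> free_part (\<beta> 1) (c + 1)"
    and u': "\<And>j. \<phi> 1 (u j) = (\<lambda>x. if x = (0, 0) then xvar j * s else 0)" by metis
  have um: "u j \<in> free_module (\<beta> 1)" for j using u free_part_subset by blast
  have "\<exists>w. w \<in> free_part (\<beta> 2) (c + 2) \<and> \<phi> 2 w = rscale (xvar i) (u j) - rscale (xvar j) (u i)" for i j
  proof -
    have "\<phi> 1 (rscale (xvar i) (u j) - rscale (xvar j) (u i)) = 0"
      by (simp add: graded_hom_diff[OF hom1] graded_hom_rscale[OF hom1] free_module_rscale um u'
          fun_eq_iff mult.left_commute del: One_nat_def)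
    moreover have "rscale (xvar i) (u j) - rscale (xvar j) (u i) \<in> free_part (\<beta> 1) (c + 2)"
      using free_part_diff[OF free_part_xvar[OF u] free_part_xvar[OF u]] by (simp add: add.assoc)
    ultimately have "rscale (xvar i) (u j) - rscale (xvar j) (u i) \<in> \<phi> 2 ` free_part (\<beta> 2) (c + 2)"
      unfolding exact1_part by simp
    then show ?thesis by force
  qed
  then obtain w where w: "\<And>i j. w i j \<in> free_part (\<beta> 2) (c + 2)"
    and w': "\<And>i j. \<phi> 2 (w i j) = rscale (xvar i) (u j) - rscale (xvar j) (u i)" by metis
  have wm: "w i j \<in> free_module (\<beta> 2)" for i j using w free_part_subset by blast
  define z where "z = rscale (xvar 0) (w 1 2) - rscale (xvar 1) (w 0 2) + rscale (xvar 2) (w 0 1)"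
  have z: "z \<in> free_part (\<beta> 2) (c + 3)"
    unfolding z_def
    using free_part_add[OF free_part_diff[OF free_part_xvar[OF w] free_part_xvar[OF w]] free_part_xvar[OF w]]
    by (simp add: add.assoc)
  have "\<phi> 2 z = rscale (xvar 0) (\<phi> 2 (w 1 2)) - rscale (xvar 1) (\<phi> 2 (w 0 2)) + rscale (xvar 2) (\<phi> 2 (w 0 1))"
    unfolding z_def
    by (simp only: graded_hom_diff[OF hom2] graded_hom_add[OF hom2] graded_hom_rscale[OF hom2]
        free_module_rscale free_module_diff wm)
  also have "\<dots> = 0" unfolding w' by (simp add: fun_eq_iff algebra_simps)
  finally have "\<phi> 2 z = 0" .
  with z have "z \<in> \<phi> 3 ` free_part (\<beta> 3) (c + 3)" unfolding exact2_part by simp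
  then obtain y where y: "y \<in> free_part (\<beta> 3) (c + 3)" "z = \<phi> 3 y" by auto
  then have "z = 0" using free_part_eq_0[OF y(1) no_shift] graded_hom_zero[OF hom3] by simp
  then have "z x = 0" for x by simp
  then have z0: "xvar 0 * w 1 2 x + xvar 1 * (- w 0 2 x) + xvar 2 * w 0 1 x = 0" for x
    by (simp add: z_def)
  \<comment> \<open>The homotopy is read off from \<open>koszul_exact_2\<close> in every coordinate,
    with p, q, r being \<open>w 1 2\<close>, \<open>- w 0 2\<close>, \<open>w 0 1\<close>. The signs
    are chosen so that \<open>w i j\<close> becomes the Koszul boundary of a.\<close>
  define a2 where "a2 = (\<lambda>x. - div_var 0 (- w 0 2 x))"
  define a1 where "a1 = (\<lambda>x. div_var 0 (w 0 1 x))"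
  define a0 where "a0 = (\<lambda>x. - div_var 1 (w 0 1 x - xvar 0 * div_var 0 (w 0 1 x)))"
  define a where "a = (\<lambda>j :: 3. if j = 0 then a0 else if j = 1 then a1 else a2)"
  have am: "a j \<in> free_module (\<beta> 2)" for j
    using wm[of 0 1] wm[of 0 2] by (auto simp: a_def a0_def a1_def a2_def free_module_def)
  have w12: "w 1 2 = rscale (xvar 1) (a 2) - rscale (xvar 2) (a 1)"
    by (rule ext) (use koszul_exact_2(1)[OF z0] in \<open>simp add: a_def a1_def a2_def\<close>)
  have w01: "w 0 1 = rscale (xvar 0) (a 1) - rscale (xvar 1) (a 0)"
    by (rule ext) (use koszul_exact_2(3)[OF z0] in \<open>simp add: a_def a1_def a0_def\<close>)
  have w02: "w 0 2 = rscale (xvar 0) (a 2) - rscale (xvar 2) (a 0)"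
  proof
    fix x
    have "w 0 2 x = - (- w 0 2 x)" by simp
    also note koszul_exact_2(2)[OF z0[of x]]
    finally show "w 0 2 x = (rscale (xvar 0) (a 2) - rscale (xvar 2) (a 0)) x"
      by (simp add: a_def a2_def a0_def)
  qed
  \<comment> \<open>Correcting the lifts by boundaries turns the relations modulo the image of
    \<open>\<phi> 2\<close> into equalities, so \<open>koszul_exact_1\<close> makes
    \<open>t 0\<close> a multiple of variable 0 without changing its image under
    \<open>\<phi> 1\<close>.\<close>
  define t where "t = (\<lambda>j. u j - \<phi> 2 (a j))"
  have tm: "t j \<in> free_module (\<beta> 1)" for j
    unfolding t_def by (intro free_module_diff um graded_hom_mem[OF hom2] am)
  have t_eq: "xvar i * t j x = xvar j * t i x"
    if "w i j = rscale (xvar i) (a j) - rscale (xvar j) (a i)" for i j x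
  proof -
    have "rscale (xvar i) (u j) - rscale (xvar j) (u i)
        = rscale (xvar i) (\<phi> 2 (a j)) - rscale (xvar j) (\<phi> 2 (a i))"
      using w'[of i j] unfolding that
      by (simp add: graded_hom_diff[OF hom2] graded_hom_rscale[OF hom2] free_module_rscale am)
    from fun_cong[OF this, of x]
    have "xvar i * u j x - xvar j * u i x = xvar i * \<phi> 2 (a j) x - xvar j * \<phi> 2 (a i) x"
      by simp
    then show ?thesis by (simp add: t_def algebra_simps)
  qed
  have "xvar i * t j x = xvar j * t i x" for i j x
  proof -
    have "i \<in> {0, 1, 2}" "j \<in> {0, 1, 2}" using UNIV_3_eq by auto
    then show ?thesis
      using t_eq[OF w12, of x] t_eq[OF w01, of x] t_eq[OF w02, of x] by auto
  qed
  then have "t 0 x = xvar 0 * div_var 0 (t 0 x)" for x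
    by (rule koszul_exact_1[of "\<lambda>j. t j x" for x])
  then have t0: "t 0 = rscale (xvar 0) (\<lambda>x. div_var 0 (t 0 x))"
    by (auto simp: fun_eq_iff)
  define b where "b = (\<lambda>x. div_var 0 (t 0 x))"
  have b: "b \<in> free_module (\<beta> 1)" using tm[of 0] by (simp add: b_def free_module_def)
  have "\<phi> 2 (a 0) \<in> \<phi> 2 ` free_module (\<beta> 2)" using am by blast
  then have "\<phi> 2 (a 0) \<in> free_module (\<beta> 1)" "\<phi> 1 (\<phi> 2 (a 0)) = 0"
    unfolding exact1 by auto
  then have "\<phi> 1 (u 0) = \<phi> 1 (t 0)"
    unfolding t_def by (simp add: graded_hom_diff[OF hom1] um del: One_nat_def)
  also have "\<dots> = rscale (xvar 0) (\<phi> 1 b)"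
    by (subst t0) (simp add: graded_hom_rscale[OF hom1 b] del: One_nat_def flip: b_def)
  finally have "\<phi> 1 (u 0) = rscale (xvar 0) (\<phi> 1 b)" .
  from fun_cong[OF this, of "(0, 0)"] have "xvar 0 * s = xvar 0 * \<phi> 1 b (0, 0)"
    unfolding u' by (simp only: rscale_apply if_True refl)
  then have "s = \<phi> 1 b (0, 0)" by (rule xvar_cancel)
  also have "\<dots> \<in> I" using exact0 b by blast
  finally show False using s(2) by simp
qed

end

section \<open>Hilbert functions of quotient algebras\<close>

lemma carrier_poly_ring [simp]: "carrier (poly_ring :: 'k::comm_ring_1 poly3 ring) = UNIV"
  and mult_poly_ring [simp]: "p \<otimes>\<^bsub>poly_ring\<^esub> q = p * (q :: 'k poly3)"
  and add_poly_ring [simp]: "p \<oplus>\<^bsub>poly_ring\<^esub> q = p + (q :: 'k poly3)"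
  and zero_poly_ring [simp]: "\<zero>\<^bsub>poly_ring\<^esub> = (0 :: 'k poly3)"
  and one_poly_ring [simp]: "\<one>\<^bsub>poly_ring\<^esub> = (1 :: 'k poly3)"
  by (simp_all add: ring_of_type_algebra_def)

lemma ring_poly_ring: "ring (poly_ring :: 'k::comm_ring_1 poly3 ring)"
  by (rule ring_from_type_algebra)

lemma ideal_poly_ringI:
  fixes J :: "'k::comm_ring_1 poly3 set"
  assumes "0 \<in> J" "\<And>p q. p \<in> J \<Longrightarrow> q \<in> J \<Longrightarrow> p + q \<in> J" "\<And>r p. p \<in> J \<Longrightarrow> r * p \<in> J"
  shows "ideal J poly_ring"
proof -
  interpret R: ring "poly_ring :: 'k poly3 ring" by (rule ring_poly_ring)
  have inv: "inv\<^bsub>add_monoid poly_ring\<^esub> p = - p" for p :: "'k poly3"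
    using R.minus_equality[of "- p" p] by (simp add: a_inv_def)
  have "subgroup J (add_monoid poly_ring)"
  proof (rule group.subgroupI[OF R.a_group])
    fix p assume "p \<in> J"
    then show "inv\<^bsub>add_monoid poly_ring\<^esub> p \<in> J" unfolding inv using assms(3)[of p "-1"] by simp
  qed (use assms(1,2) in auto)
  then show ?thesis
    by (rule idealI[OF ring_poly_ring]) (use assms(3) in \<open>auto simp: mult.commute\<close>)
qed

section \<open>Linear algebra in the quotient by a proper ideal\<close>

locale proper_ideal =
  fixes I :: "'k::field poly3 set"
  assumes is_ideal: "ideal I poly_ring" and one_notin: "1 \<notin> I"
begin

sublocale I: ideal I "poly_ring :: 'k poly3 ring" by (rule is_ideal)

lemma zero_mem: "0 \<in> I"
  using additive_subgroup.zero_closed[OF ideal.axioms(1)[OF is_ideal]] by simp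

lemma mult_mem: "p \<in> I \<Longrightarrow> r * p \<in> I"
  using I.I_l_closed[of p r] by simp

lemma add_mem: "p \<in> I \<Longrightarrow> q \<in> I \<Longrightarrow> p + q \<in> I"
  using additive_subgroup.a_closed[OF ideal.axioms(1)[OF is_ideal], of p q] by simp

lemma uminus_mem: "p \<in> I \<Longrightarrow> - p \<in> I"
  using mult_mem[of p "-1"] by simp

lemma quot_class_eq_iff: "quot_class I p = quot_class I q \<longleftrightarrow> p - q \<in> I"
proof
  assume *: "quot_class I p = quot_class I q"
  have "p \<in> quot_class I p" using zero_mem by (force simp: quot_class_def a_r_coset_def')
  then show "p - q \<in> I" unfolding * by (auto simp: quot_class_def a_r_coset_def')
next
  have sub: "quot_class I p \<subseteq> quot_class I q" if "p - q \<in> I" for p q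
  proof
    fix x assume "x \<in> quot_class I p"
    then obtain h where h: "h \<in> I" "x = h + p" by (auto simp: quot_class_def a_r_coset_def')
    then have "x = (h + (p - q)) + q" by simp
    with add_mem[OF h(1) that] show "x \<in> quot_class I q"
      unfolding quot_class_def a_r_coset_def' add_poly_ring by blast
  qed
  assume "p - q \<in> I"
  moreover from uminus_mem[OF this] have "q - p \<in> I" by simp
  ultimately show "quot_class I p = quot_class I q" using sub by blast
qed

lemma quot_class_hom: "ring_hom_ring poly_ring (quot_alg I) (quot_class I)"
  using I.rcos_ring_hom_ring unfolding quot_alg_def quot_class_def .

sublocale Q: ring_hom_ring "poly_ring :: 'k poly3 ring" "quot_alg I" "quot_class I"
  by (rule quot_class_hom)

lemma quot_class_mult: "quot_class I p \<otimes>\<^bsub>quot_alg I\<^esub> quot_class I q = quot_class I (p * q)"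
  using Q.hom_mult[of p q] by simp

lemma quot_class_add: "quot_class I p \<oplus>\<^bsub>quot_alg I\<^esub> quot_class I q = quot_class I (p + q)"
  using Q.hom_add[of p q] by simp

lemma quot_class_0: "quot_class I 0 = \<zero>\<^bsub>quot_alg I\<^esub>"
  using Q.hom_zero by simp

lemma quot_class_1: "quot_class I 1 = \<one>\<^bsub>quot_alg I\<^esub>"
  using Q.hom_one by simp

lemma quot_class_eq_0_iff: "quot_class I p = \<zero>\<^bsub>quot_alg I\<^esub> \<longleftrightarrow> p \<in> I"
  using quot_class_eq_iff[of p 0] by (simp add: quot_class_0)

lemma quot_class_closed: "quot_class I p \<in> carrier (quot_alg I)"
  using Q.hom_closed[of p] by simp

text \<open>The scalars are the image of a field under a ring homomorphism, and 1 does not map to 0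
  because the ideal is proper.\<close>

lemma subfield_quot_scalars: "subfield (quot_scalars I) (quot_alg I)"
proof -
  define K where "K = (ring_of_type_algebra :: 'k ring)"
  have K: "carrier K = UNIV" "ring K" "field K"
    unfolding K_def by (simp add: ring_of_type_algebra_def, rule ring_from_type_algebra, rule field_from_type_algebra)
  have "ring_hom_ring K (quot_alg I) (\<lambda>a. quot_class I (const_poly a))"
    by (rule ring_hom_ringI[OF K(2) Q.S.ring_axioms])
      (auto simp: quot_class_closed K_def ring_of_type_algebra_def quot_class_mult quot_class_add
        const_poly_add const_poly_mult const_poly_1 quot_class_1)
  from ring_hom_ring.img_is_subfield(2)[OF this field.carrier_is_subfield[OF K(3)]]
  show ?thesis
    using one_notin quot_class_eq_0_iff[of 1] by (simp add: K(1) quot_scalars_def quot_class_1)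
qed

text \<open>This translates between the list-based span in the quotient ring and the set-based span
  of polynomials.\<close>

lemma Span_quot_class:
  "Q.S.Span (quot_scalars I) (map (quot_class I) xs) = quot_class I ` pv.span (set xs)"
proof (induction xs)
  case Nil
  then show ?case by (simp add: quot_class_0)
next
  case (Cons x xs)
  have "u \<in> Q.S.line_extension (quot_scalars I) (quot_class I x) (quot_class I ` pv.span (set xs))
      \<longleftrightarrow> u \<in> quot_class I ` pv.span (insert x (set xs))" for u
  proof
    assume "u \<in> Q.S.line_extension (quot_scalars I) (quot_class I x) (quot_class I ` pv.span (set xs))"
    then obtain a v where "v \<in> pv.span (set xs)" "u = quot_class I (const_poly a * x + v)"
      unfolding Q.S.line_extension_mem_iff quot_scalars_def by (auto simp: quot_class_mult quot_class_add)
    moreover from this(1) have "const_poly a * x + v \<in> pv.span (insert x (set xs))"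
      unfolding pv.span_breakdown_eq by (intro exI[of _ a]) (simp add: pscale_def)
    ultimately show "u \<in> quot_class I ` pv.span (insert x (set xs))" by blast
  next
    assume "u \<in> quot_class I ` pv.span (insert x (set xs))"
    then obtain y a where "u = quot_class I y" "y - const_poly a * x \<in> pv.span (set xs)"
      by (auto simp: pv.span_insert pscale_def)
    moreover from this have "u = quot_class I (const_poly a) \<otimes>\<^bsub>quot_alg I\<^esub> quot_class I x
        \<oplus>\<^bsub>quot_alg I\<^esub> quot_class I (y - const_poly a * x)"
      by (simp add: quot_class_mult quot_class_add)
    ultimately show "u \<in> Q.S.line_extension (quot_scalars I) (quot_class I x) (quot_class I ` pv.span (set xs))"
      unfolding Q.S.line_extension_mem_iff quot_scalars_def by blast
  qed
  then show ?case using Cons.IH by auto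
qed

text \<open>Here \<open>B\<close> plays the part of a basis of the relevant piece of I: a dependence
  among the classes lifts to a dependence in \<open>set xs \<union> B\<close>.\<close>

lemma independent_quot_class:
  assumes "distinct xs" "set xs \<inter> B = {}" "pv.independent (set xs \<union> B)"
    and "pv.span (set xs) \<inter> I \<subseteq> pv.span B"
  shows "Q.S.independent (quot_scalars I) (map (quot_class I) xs)"
  using assms
proof (induction xs)
  case (Cons x xs)
  have "pv.span (set xs) \<subseteq> pv.span (set (x # xs))" by (rule pv.span_mono) auto
  moreover have "pv.independent (set xs \<union> B)"
    using Cons.prems(3) by (rule pv.independent_mono) auto
  ultimately have "Q.S.independent (quot_scalars I) (map (quot_class I) xs)"
    using Cons.prems by (intro Cons.IH) auto
  moreover have "quot_class I x \<notin> Q.S.Span (quot_scalars I) (map (quot_class I) xs)"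
    unfolding Span_quot_class
  proof
    assume "quot_class I x \<in> quot_class I ` pv.span (set xs)"
    then obtain y where y: "y \<in> pv.span (set xs)" "x - y \<in> I" by (auto simp: quot_class_eq_iff)
    have "x - y \<in> pv.span (set (x # xs))"
      using y(1) \<open>pv.span (set xs) \<subseteq> _\<close> pv.span_base[of x "set (x # xs)"] by (intro pv.span_diff) auto
    then have "x - y \<in> pv.span B" using Cons.prems(4) y(2) by auto
    then have "(x - y) + y \<in> pv.span (set xs \<union> B)"
      using y(1) pv.span_mono[of "set xs" "set xs \<union> B"] pv.span_mono[of B "set xs \<union> B"]
      by (intro pv.span_add) auto
    then have "x \<in> pv.span (set xs \<union> B)" by simp
    moreover have "x \<notin> set xs \<union> B" "pv.independent (insert x (set xs \<union> B))"
      using Cons.prems by auto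
    ultimately show False by (simp add: pv.independent_insert)
  qed
  ultimately show ?case
    using Q.S.independent.li_Cons quot_class_closed by (simp del: Q.S.Span.simps)
qed simp

text \<open>A basis of \<open>I \<inter> P\<close> is extended to one of P; the classes of the added
  vectors form a basis of the image.\<close>

lemma dim_quot_class_image:
  assumes P: "pv.subspace P" "finite T" "P \<subseteq> pv.span T"
  shows "Q.S.dim (quot_scalars I) (quot_class I ` P) + pv.dim (I \<inter> P) = pv.dim P"
proof -
  obtain B1 where B1: "B1 \<subseteq> I \<inter> P" "pv.independent B1" "I \<inter> P \<subseteq> pv.span B1" "card B1 = pv.dim (I \<inter> P)"
    by (rule pv.basis_exists)
  obtain B where B: "B1 \<subseteq> B" "B \<subseteq> P" "pv.independent B" "P \<subseteq> pv.span B"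
    using pv.maximal_independent_subset_extend[of B1 P] B1(1,2) by auto
  have fin: "finite B" using pv.independent_span_bound[OF P(2) B(3)] B(2) P(3) by auto
  then obtain xs where xs: "set xs = B - B1" "distinct xs"
    using finite_distinct_list[of "B - B1"] by auto
  have spanP: "pv.span (set xs) \<subseteq> P"
    using P(1) B(2) xs(1) by (intro pv.span_minimal) auto
  have "Q.S.independent (quot_scalars I) (map (quot_class I) xs)"
    by (rule independent_quot_class[of _ B1])
      (use xs B(1,3) B1(3) spanP in \<open>auto simp: Un_absorb1 Un_absorb2\<close>)
  moreover have "quot_class I ` P = quot_class I ` pv.span (set xs)"
  proof (intro equalityI image_subsetI)
    fix p assume "p \<in> P"
    then have "p \<in> pv.span (B1 \<union> set xs)" using B(1,4) xs(1) by (auto simp: Un_absorb1)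
    then obtain u v where uv: "u \<in> pv.span B1" "v \<in> pv.span (set xs)" "p = u + v"
      unfolding pv.span_Un by auto
    have "pv.subspace I"
      by (rule pv.subspaceI) (auto simp: zero_mem add_mem mult_mem pscale_def)
    then have "u \<in> I" using uv(1) B1(1) pv.span_minimal[of B1 I] by auto
    then have "quot_class I p = quot_class I v" using uv(3) by (simp add: quot_class_eq_iff)
    then show "quot_class I p \<in> quot_class I ` pv.span (set xs)" using uv(2) by auto
  qed (use spanP in auto)
  ultimately have "Q.S.dimension (length xs) (quot_scalars I) (quot_class I ` P)"
    using Q.S.dimension_independent[of "quot_scalars I" "map (quot_class I) xs"]
    by (simp only: Span_quot_class length_map)
  then have "Q.S.dim (quot_scalars I) (quot_class I ` P) = length xs"
    using Q.S.dimI[OF subfield_quot_scalars] by (simp add: over_def)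
  moreover have "length xs = card B - card B1"
    using xs B(1) fin by (metis card_Diff_subset distinct_card finite_subset)
  moreover have "card B1 \<le> card B" using card_mono[OF fin B(1)] .
  moreover have "card B = pv.dim P" using pv.basis_card_eq_dim[OF B(2,4,3)] .
  ultimately show ?thesis using B1(4) by simp
qed

text \<open>The forms of degree n are identified with the degree n part of a free module on one
  generator of degree 0, so the earlier monomial count gives their dimension.\<close>

lemma hilb_eq:
  "hilb I n + pv.dim {p \<in> I. is_form n p} = card (mono_set n)"
proof -
  define b :: "int \<Rightarrow> nat" where "b = (\<lambda>d. if d = 0 then 1 else 0)"
  have b: "shifts b = {0}" by (auto simp: shifts_def b_def)
  define P where "P = {p :: 'k poly3. is_form n p}"
  define f where "f = (\<lambda>v :: 'k fvec. v (0, 0))"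
  have linear: "Vector_Spaces.linear fscale pscale f"
    using pv.vector_space_axioms fv.vector_space_axioms
    unfolding Vector_Spaces.linear_iff f_def by (simp add: fscale_def pscale_def)
  have image: "f ` free_part b n = P"
  proof (intro equalityI subsetI)
    fix p assume "p \<in> P"
    then show "p \<in> f ` free_part b n"
      by (intro image_eqI[of _ _ "\<lambda>x. if x = (0, 0) then p else 0"])
        (auto simp: P_def f_def free_part_def free_module_def b_def is_form_zero)
  qed (auto simp: P_def f_def free_part_def dest: spec[of _ 0])
  have kernel: "{v \<in> free_part b n. f v = 0} = {0}"
  proof (intro equalityI subsetI)
    fix v assume "v \<in> {v \<in> free_part b n. f v = 0}"
    then have v: "v \<in> free_module b" "v (0, 0) = 0" using free_part_subset by (auto simp: f_def)
    have "v (d, j) = 0" for d j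
    proof (cases "(d, j) = (0, 0)")
      case False
      then have "b d \<le> j" by (auto simp: b_def)
      then show ?thesis using v(1) by (simp add: free_module_def)
    qed (use v(2) in simp)
    then show "v \<in> {0}" by (auto simp: fun_eq_iff)
  qed (use fv.subspace_0[OF subspace_free_part] in \<open>auto simp: f_def\<close>)
  have finb: "finite (shifts b)" by (simp add: b)
  have zero: "fv.dim {0 :: 'k fvec} = 0"
    by (rule fv.dim_unique[of "{}"]) (auto simp: fv.independent_empty)
  have "pv.dim P = fv.dim (free_part b n :: 'k fvec set)"
    using fpv.dim_eq_dim_kernel_plus_dim_image[OF linear subspace_free_part _ free_part_subset_span[OF finb], of n]
    by (simp only: kernel image zero finite_imageI finite_part_index[OF finb])
  also have "\<dots> = card (mono_set n)"
    unfolding dim_free_part[OF finb] b by (simp add: b_def)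
  finally have dimP: "pv.dim P = card (mono_set n)" .
  interpret f: Vector_Spaces.linear fscale pscale f by (rule linear)
  have "P \<subseteq> pv.span (f ` mono_vec ` part_index b n)"
    using f.spans_image[OF free_part_subset_span[OF finb, of n]] unfolding image .
  moreover have "pv.subspace P"
    using f.subspace_image[OF subspace_free_part] image by metis
  ultimately have "Q.S.dim (quot_scalars I) (quot_class I ` P) + pv.dim (I \<inter> P) = pv.dim P"
    using finite_part_index[OF finb] by (intro dim_quot_class_image) auto
  moreover have "I \<inter> P = {p \<in> I. is_form n p}" by (auto simp: P_def)
  ultimately show ?thesis
    by (simp add: hilb_def quot_part_def dimP flip: P_def)
qed

lemma quot_part_eq_0_iff: "quot_part I n = {\<zero>\<^bsub>quot_alg I\<^esub>} \<longleftrightarrow> (\<forall>p. is_form n p \<longrightarrow> p \<in> I)"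
proof -
  have "quot_part I n \<noteq> {}" using is_form_zero[of n] by (auto simp: quot_part_def)
  then have "quot_part I n = {\<zero>\<^bsub>quot_alg I\<^esub>} \<longleftrightarrow> quot_part I n \<subseteq> {\<zero>\<^bsub>quot_alg I\<^esub>}"
    by (simp only: subset_singleton_iff simp_thms)
  then show ?thesis by (simp add: quot_part_def image_subset_iff quot_class_eq_0_iff)
qed

text \<open>Polynomials without terms below a given degree form an ideal. Letting the bound run
  through an infinite set of nonzero degrees would make every step of the induced chain in the
  quotient strict.\<close>

lemma finite_nonzero_degrees:
  assumes hom: "homogeneous_ideal I" and art: "artinian (quot_alg I)"
  shows "finite {n. \<exists>p. is_form (int n) p \<and> p \<notin> I}"
proof (rule ccontr)
  define S where "S = {n. \<exists>p. is_form (int n) p \<and> p \<notin> I}"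
  assume "infinite {n. \<exists>p. is_form (int n) p \<and> p \<notin> I}"
  then have inf: "infinite S" by (simp add: S_def)
  define M where "M = (\<lambda>n. {p :: 'k poly3. \<forall>m\<in>Poly_Mapping.keys p. n \<le> mdeg m})"
  have ideal_M: "ideal (M n) poly_ring" for n
  proof (rule ideal_poly_ringI)
    fix p q :: "'k poly3" assume "p \<in> M n" "q \<in> M n"
    then show "p + q \<in> M n"
      using keys_add[of p q] unfolding M_def by blast
  next
    fix r p :: "'k poly3" assume p: "p \<in> M n"
    show "r * p \<in> M n"
      unfolding M_def
    proof (intro CollectI ballI)
      fix m assume "m \<in> Poly_Mapping.keys (r * p)"
      then obtain m1 m2 where "m = m1 + m2" "m2 \<in> Poly_Mapping.keys p"
        using keys_mult[of r p] by auto
      then show "n \<le> mdeg m" using p by (auto simp: M_def mdeg_add intro: trans_le_add2)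
    qed
  qed (simp add: M_def)
  define J where "J = (\<lambda>k. quot_class I ` M (enumerate S k))"
  have "ideal (J k) (quot_alg I)" for k
    using ring.ring_ideal_imp_quot_ideal[OF ring_poly_ring is_ideal ideal_M]
    unfolding J_def quot_alg_def quot_class_def .
  moreover have "J (Suc k) \<subset> J k" for k
  proof -
    have lt: "enumerate S k < enumerate S (Suc k)" using inf by (rule enumerate_step)
    then have "M (enumerate S (Suc k)) \<subseteq> M (enumerate S k)" by (auto simp: M_def)
    then have "J (Suc k) \<subseteq> J k" unfolding J_def by (rule image_mono)
    moreover have "enumerate S k \<in> S" using inf by (rule enumerate_in_set)
    then obtain p where p: "is_form (int (enumerate S k)) p" "p \<notin> I" by (auto simp: S_def)
    from p(1) have "quot_class I p \<in> J k" unfolding J_def M_def is_form_def by auto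
    moreover have "quot_class I p \<notin> J (Suc k)"
    proof
      assume "quot_class I p \<in> J (Suc k)"
      then obtain q where q: "q \<in> M (enumerate S (Suc k))" "p - q \<in> I"
        by (auto simp: J_def quot_class_eq_iff)
      \<comment> \<open>Here homogeneity is decisive: q starts in a higher degree, so p is a
        component of \<open>p - q\<close> and would lie in I.\<close>
      have "hom_component (enumerate S k) (p - q) = p"
      proof (rule poly_mapping_eqI)
        fix m
        have "Poly_Mapping.lookup q m = 0" if "mdeg m = enumerate S k"
        proof (rule ccontr)
          assume "Poly_Mapping.lookup q m \<noteq> 0"
          then have "enumerate S (Suc k) \<le> mdeg m" using q(1) by (simp add: M_def in_keys_iff)
          then show False using lt that by simp
        qed
        moreover have "Poly_Mapping.lookup p m = 0" if "mdeg m \<noteq> enumerate S k"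
          using p(1) that by (auto simp: is_form_iff)
        ultimately show "Poly_Mapping.lookup (hom_component (enumerate S k) (p - q)) m = Poly_Mapping.lookup p m"
          by (simp add: lookup_hom_component lookup_minus)
      qed
      then show False using hom q(2) p(2) unfolding homogeneous_ideal_def by metis
    qed
    ultimately show ?thesis by blast
  qed
  ultimately show False using art unfolding artinian_def by blast
qed

text \<open>The greatest degree is well defined: the set of nonzero degrees contains 0, as the ideal
  is proper, and it is finite.\<close>

lemma socle_degree:
  assumes "homogeneous_ideal I" "artinian (quot_alg I)"
  shows "\<exists>p. is_form (int (socle_degree I)) p \<and> p \<notin> I"
    and "int (socle_degree I) < n \<Longrightarrow> is_form n p \<Longrightarrow> p \<in> I"
proof -
  define S where "S = {n. \<exists>p. is_form (int n) p \<and> p \<notin> I}"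
  have fin: "finite S" unfolding S_def by (rule finite_nonzero_degrees[OF assms])
  have "0 \<in> S"
    using one_notin is_form_single[of 0 "1 :: 'k"] by (auto simp: S_def mdeg_def intro!: exI[of _ 1])
  have eq: "socle_degree I = (GREATEST n. n \<in> S)"
    unfolding socle_degree_def S_def quot_part_eq_0_iff by simp
  have le: "k \<in> S \<Longrightarrow> k \<le> Max S" for k using fin by simp
  show "\<exists>p. is_form (int (socle_degree I)) p \<and> p \<notin> I"
    using GreatestI_nat[of "\<lambda>n. n \<in> S", OF \<open>0 \<in> S\<close> le] unfolding eq by (simp add: S_def)
  show "p \<in> I" if n: "int (socle_degree I) < n" and p: "is_form n p"
  proof (rule ccontr)
    assume "p \<notin> I"
    then have "nat n \<in> S" using n p by (auto simp: S_def)
    then have "nat n \<le> socle_degree I"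
      unfolding eq by (rule Greatest_le_nat[of "\<lambda>n. n \<in> S"]) (rule le)
    then show False using n by simp
  qed
qed

end

text \<open>If no third difference in positive degree were positive, then the second differences
  would decrease to 0, the first differences would increase from \<open>h 0\<close>, and \<open>h\<close> could not
  vanish eventually.\<close>

lemma exists_pos_third_difference:
  fixes h :: "int \<Rightarrow> int"
  assumes neg: "\<And>n. n < 0 \<Longrightarrow> h n = 0" and large: "\<And>n. n > int c \<Longrightarrow> h n = 0" and "h 0 > 0"
  shows "\<exists>n > 0. h (int n) - 3 * h (int n - 1) + 3 * h (int n - 2) - h (int n - 3) > 0"
proof (rule ccontr)
  assume contra: "\<not> ?thesis"
  define D2 where "D2 = (\<lambda>n. h (int n) - 2 * h (int n - 1) + h (int n - 2))"
  have D2_step: "D2 (Suc n) \<le> D2 n" for n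
  proof -
    have "\<not> h (int (Suc n)) - 3 * h (int (Suc n) - 1) + 3 * h (int (Suc n) - 2) - h (int (Suc n) - 3) > 0"
      using contra zero_less_Suc by blast
    then show ?thesis by (simp add: D2_def)
  qed
  have D2_nonneg: "D2 n \<ge> 0" for n
  proof -
    \<comment> \<open>\<open>D2\<close> looks back two places, so the shift \<open>c + 3\<close>
      puts all three arguments above c, where h vanishes.\<close>
    have "D2 (n + (c + 3)) \<le> D2 n"
      by (rule lift_Suc_antimono_le[of D2]) (simp_all add: D2_step)
    then show ?thesis using large by (simp add: D2_def)
  qed
  have "h (int n) - h (int n - 1) \<ge> h 0" for n
  proof (induction n)
    case (Suc n)
    then show ?case using D2_nonneg[of "Suc n"] by (simp add: D2_def)
  qed (use neg in simp)
  from this[of "c + 3"] show False using large \<open>h 0 > 0\<close> by simp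
qed

lemma min_shift_bounds:
  assumes "finite (shifts b)" "b d > 0" "\<And>d. b d > 0 \<Longrightarrow> d > 0"
  shows "min_shift b \<le> d" "min_shift b > 0"
proof -
  have "d \<in> shifts b" using assms(2) by (simp add: shifts_def)
  then show "min_shift b \<le> d" using assms(1) by (simp add: min_shift_def)
  have "min_shift b \<in> shifts b"
    unfolding min_shift_def using assms(1) \<open>d \<in> shifts b\<close> by (intro Min_in) auto
  then show "min_shift b > 0" using assms(3) by (simp add: shifts_def)
qed

theorem proposition3p4:
  fixes I :: "'k::field_char_0 poly3 set"
    and \<beta> :: "nat \<Rightarrow> int \<Rightarrow> nat"
    and \<phi> :: "nat \<Rightarrow> 'k fvec \<Rightarrow> 'k fvec"
  assumes "homogeneous_ideal I"
    and "artinian (quot_alg I)"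
    and "\<not> (\<exists>p \<in> I. p \<noteq> 0 \<and> is_form 1 p)"
    and "minimal_free_resolution I \<beta> \<phi>"
    and "real (initial_degree I * first_pos_diff I * (socle_degree I + 3)) / 6 \<le> real (alg_multiplicity I)"
  shows "real_of_int (min_shift (\<beta> 1) * min_shift (\<beta> 2) * min_shift (\<beta> 3)) / 6
           \<le> real (alg_multiplicity I)"
proof -
  have ideal: "ideal I poly_ring" using assms(1) by (simp add: homogeneous_ideal_def)
  \<comment> \<open>Properness comes from the absence of linear forms: otherwise the variable
    \<open>xvar 0\<close> would lie in I.\<close>
  have "1 \<notin> I"
  proof
    assume "1 \<in> I"
    then have "xvar 0 \<in> I"
      using ideal.I_l_closed[OF ideal, of 1 "xvar 0"] by simp
    moreover have "xvar 0 \<noteq> (0 :: 'k poly3)"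
      unfolding xvar_def by (metis lookup_single_eq lookup_zero one_neq_zero)
    moreover have "is_form 1 (xvar 0 :: 'k poly3)"
      unfolding xvar_def using is_form_single[of "Poly_Mapping.single 0 1"] by (simp add: mdeg_single)
    ultimately show False using assms(3) by blast
  qed
  with ideal interpret proper_ideal I by (rule proper_ideal.intro)
  interpret min_res I \<beta> \<phi> by (rule min_res.intro[OF assms(4)])
  define c where "c = socle_degree I"
  note socle = socle_degree[OF assms(1,2), folded c_def]
  have third_diff: "third_diff I n = (if n = 0 then 1 else 0) - int (\<beta> 1 n) + int (\<beta> 2 n) - int (\<beta> 3 n)" for n
  proof -
    have "int (hilb I n) = int (card (mono_set n)) - int (pv.dim {p \<in> I. is_form n p})" for n
      using hilb_eq[of n] by linarith
    then show ?thesis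
      using third_diff_card_mono_set[of n] third_diff_dim_free_part[OF finite_shifts(1), where 'k = 'k, of n]
        third_diff_dim_free_part[OF finite_shifts(2), where 'k = 'k, of n]
        third_diff_dim_free_part[OF finite_shifts(3), where 'k = 'k, of n]
      unfolding third_diff_def dim_ideal_part by simp
  qed
  have hilb_neg: "hilb I n = 0" if "n < 0" for n
    using hilb_eq[of n] that by (simp add: mono_set_neg)
  \<comment> \<open>Both parts are zero, so vanishing above c is inherited from the negative degree
    -1.\<close>
  have "quot_part I n = quot_part I (-1)" if "n > int c" for n
    using that socle(2) quot_part_eq_0_iff[of n] quot_part_eq_0_iff[of "-1"] is_form_neg[of "-1"] zero_mem
    by fastforce
  then have hilb_large: "hilb I n = 0" if "n > int c" for n
    using that hilb_neg[of "-1"] by (simp add: hilb_def)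
  \<comment> \<open>Without shifts at 0, the third difference at 0 is 1; this supplies the positive
    starting value \<open>hilb I 0\<close> needed for the existence of i.\<close>
  have "\<beta> l 0 = 0" if "l \<in> {1, 2, 3}" for l
    using that shifts_1_pos[of 0] shifts_2_pos[of 0] shifts_3_pos[of 0] by auto
  then have "third_diff I 0 = 1" by (simp add: third_diff)
  then have "hilb I 0 > 0" using hilb_neg by (simp add: third_diff_def)
  with hilb_neg hilb_large have "\<exists>n. n > 0 \<and> third_diff I (int n) > 0"
    unfolding third_diff_def by (intro exists_pos_third_difference[of "\<lambda>n. int (hilb I n)" c]) auto
  then have i: "first_pos_diff I > 0" "third_diff I (int (first_pos_diff I)) > 0"
    unfolding first_pos_diff_def by (metis (mono_tags, lifting) LeastI_ex)+
  then have "\<beta> 2 (int (first_pos_diff I)) > 0" by (simp add: third_diff split: if_splits)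
  then have m2: "min_shift (\<beta> 2) \<le> int (first_pos_diff I)" and m2_pos: "min_shift (\<beta> 2) > 0"
    using min_shift_bounds[OF finite_shifts(2) _ shifts_2_pos] by blast+
  obtain s where s: "is_form (int c) s" "s \<notin> I" using socle(1) by auto
  have "xvar j * s \<in> I" for j
    using is_form_xvar_times[OF s(1)] by (rule socle(2)[rotated]) simp
  then obtain d3 where d3: "\<beta> 3 d3 > 0" "d3 \<le> int c + 3" using shift_3_le[OF s] by blast
  then have "min_shift (\<beta> 3) \<le> d3" and m3_pos: "min_shift (\<beta> 3) > 0"
    using min_shift_bounds[OF finite_shifts(3) _ shifts_3_pos] d3(1) by blast+
  with d3 have m3: "min_shift (\<beta> 3) \<le> int (c + 3)" by simp
  \<comment> \<open>A power of a variable just above the socle degree lies in I. It shows that the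
    minimum defining \<open>initial_degree\<close> is attained.\<close>
  define m :: "3 \<Rightarrow>\<^sub>0 nat" where "m = Poly_Mapping.single 0 (Suc c)"
  have "Poly_Mapping.single m 1 \<in> I"
    by (rule socle(2)[OF _ is_form_single]) (simp add: m_def mdeg_single)
  moreover have "Poly_Mapping.single m 1 \<noteq> (0 :: 'k poly3)"
    by (metis lookup_single_eq lookup_zero one_neq_zero)
  ultimately have "\<exists>n. \<exists>p\<in>I. p \<noteq> 0 \<and> is_form (int n) p" using is_form_single by blast
  then have "\<exists>p\<in>I. p \<noteq> 0 \<and> is_form (int (initial_degree I)) p"
    unfolding initial_degree_def by (rule LeastI_ex)
  then obtain d1 where d1: "\<beta> 1 d1 > 0" "d1 \<le> int (initial_degree I)" using shift_1_le by metis
  then have "min_shift (\<beta> 1) \<le> d1" and m1_pos: "min_shift (\<beta> 1) > 0"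
    using min_shift_bounds[OF finite_shifts(1) _ shifts_1_pos] d1(1) by blast+
  with d1 have m1: "min_shift (\<beta> 1) \<le> int (initial_degree I)" by simp
  \<comment> \<open>Multiplying the three bounds is legitimate because all the shifts are
    positive.\<close>
  have "min_shift (\<beta> 1) * min_shift (\<beta> 2) * min_shift (\<beta> 3)
      \<le> int (initial_degree I) * int (first_pos_diff I) * int (c + 3)"
    using m1 m2 m3 m1_pos m2_pos m3_pos by (intro mult_mono) auto
  then have "real_of_int (min_shift (\<beta> 1) * min_shift (\<beta> 2) * min_shift (\<beta> 3))
      \<le> real_of_int (int (initial_degree I) * int (first_pos_diff I) * int (c + 3))"
    by (simp only: of_int_le_iff)
  also have "\<dots> = real (initial_degree I * first_pos_diff I * (c + 3))" by simp
  finally show ?thesis using assms(5) unfolding c_def by linarith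
qed

end
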